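(* For $s=1,2,4$ let $M_s=\frac1s(u_{11}+u_{22}+\ldots+u_{ss})\in A_s(4)$, where $u=(u_{ij})$ is the fundamental corepresentation of $A_s(4)$. Then $$\mathrm{law}(M_s)=\left(1-\frac s4\right)\delta_0+\frac s4\,\mu_s,$$ where $\mu_1=\delta_1$ is the Dirac mass at $1$, $\mu_2=\lambda_1$ is the Lebesgue measure on $[0,1]$, and $\mu_4=\nu_1$ is the probability measure on $[0,1]$ given by $\nu_1=\frac{2}{\pi}\sqrt{x^{-1}-1}\,dx$.
   Context: A magic unitary over a $C^*$-algebra $A$ is a square matrix over $A$ whose entries are projections, such that on each row and on each column the entries are pairwise orthogonal and sum up to $1$. $A_s(4)$ (the notation $A_s(n)$ uses "$s$" for "symmetric", unrelated to the index $s$ of $M_s$) is the universal $C^*$-algebra generated by $16$ elements $u_{ij}$ ($1\le i,j\le 4$) with the relations making $u=(u_{ij})$ a magic unitary matrix. It is a Hopf algebra in the sense of Woronowicz, with comultiplication $\Delta(u_{ij})=\sum_k u_{ik}\otimes u_{kj}$. Let $\int:A_s(4)\to\mathbb C$ be its Haar functional, i.e. the unique state which is left and right invariant with respect to $\Delta$. The law of a self-adjoint element $a\in A_s(4)$ is the unique compactly supported probability measure on $\mathbb R$ whose $k$-th moment is $\int a^k$, for all $k\ge 0$. *)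

theory Defs
  imports "HOL-Algebra.Algebraic_Closure_Type" "HOL-Probability.Probability"
begin

section \<open>Unital C*-algebras\<close>

record 'a cstar = "(complex, 'a) module" +
  adj :: "'a \<Rightarrow> 'a"
  cnorm :: "'a \<Rightarrow> real"

text \<open>The locale \<open>Metric_space\<close> wants symmetry and nonnegativity also off the carrier.\<close>

definition cdist :: "'a cstar \<Rightarrow> 'a \<Rightarrow> 'a \<Rightarrow> real" where
  "cdist A x y =
     (if x \<in> carrier A \<and> y \<in> carrier A then cnorm A (x \<ominus>\<^bsub>A\<^esub> y) else 0)"

abbreviation ctop :: "'a cstar \<Rightarrow> 'a topology" where
  "ctop A \<equiv> Metric_space.mtopology (carrier A) (cdist A)"

text \<open>The locale \<open>algebra\<close> of \<open>HOL-Algebra\<close> is restricted to commutative algebras, hence the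
  explicit compatibility axioms \<open>smult_mult_left\<close> and \<open>smult_mult_right\<close>.\<close>

locale cstar_algebra =
  A: ring A + V: Module.module "ring_of_type_algebra :: complex ring" A for A :: "'a cstar" (structure) +
  assumes smult_mult_left:
      "\<lbrakk>x \<in> carrier A; y \<in> carrier A\<rbrakk> \<Longrightarrow> (c \<odot>\<^bsub>A\<^esub> x) \<otimes>\<^bsub>A\<^esub> y = c \<odot>\<^bsub>A\<^esub> (x \<otimes>\<^bsub>A\<^esub> y)"
    and smult_mult_right:
      "\<lbrakk>x \<in> carrier A; y \<in> carrier A\<rbrakk> \<Longrightarrow> x \<otimes>\<^bsub>A\<^esub> (c \<odot>\<^bsub>A\<^esub> y) = c \<odot>\<^bsub>A\<^esub> (x \<otimes>\<^bsub>A\<^esub> y)"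
    and adj_closed: "x \<in> carrier A \<Longrightarrow> adj A x \<in> carrier A"
    and adj_adj: "x \<in> carrier A \<Longrightarrow> adj A (adj A x) = x"
    and adj_add: "\<lbrakk>x \<in> carrier A; y \<in> carrier A\<rbrakk> \<Longrightarrow> adj A (x \<oplus>\<^bsub>A\<^esub> y) = adj A x \<oplus>\<^bsub>A\<^esub> adj A y"
    and adj_smult: "x \<in> carrier A \<Longrightarrow> adj A (c \<odot>\<^bsub>A\<^esub> x) = cnj c \<odot>\<^bsub>A\<^esub> adj A x"
    and adj_mult: "\<lbrakk>x \<in> carrier A; y \<in> carrier A\<rbrakk> \<Longrightarrow> adj A (x \<otimes>\<^bsub>A\<^esub> y) = adj A y \<otimes>\<^bsub>A\<^esub> adj A x"
    and cnorm_nonneg: "x \<in> carrier A \<Longrightarrow> 0 \<le> cnorm A x"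
    and cnorm_eq_0: "x \<in> carrier A \<Longrightarrow> cnorm A x = 0 \<longleftrightarrow> x = \<zero>\<^bsub>A\<^esub>"
    and cnorm_add: "\<lbrakk>x \<in> carrier A; y \<in> carrier A\<rbrakk> \<Longrightarrow> cnorm A (x \<oplus>\<^bsub>A\<^esub> y) \<le> cnorm A x + cnorm A y"
    and cnorm_smult: "x \<in> carrier A \<Longrightarrow> cnorm A (c \<odot>\<^bsub>A\<^esub> x) = cmod c * cnorm A x"
    and cnorm_mult: "\<lbrakk>x \<in> carrier A; y \<in> carrier A\<rbrakk> \<Longrightarrow> cnorm A (x \<otimes>\<^bsub>A\<^esub> y) \<le> cnorm A x * cnorm A y"
    and cstar_identity: "x \<in> carrier A \<Longrightarrow> cnorm A (adj A x \<otimes>\<^bsub>A\<^esub> x) = (cnorm A x)\<^sup>2"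
    and complete: "Metric_space.mcomplete (carrier A) (cdist A)"

lemma (in cstar_algebra) Metric_space_cdist: "Metric_space (carrier A) (cdist A)"
proof
  fix x y z
  show "0 \<le> cdist A x y"
    by (simp add: cdist_def cnorm_nonneg)
  show "cdist A x y = cdist A y x"
  proof (cases "x \<in> carrier A \<and> y \<in> carrier A")
    case True
    let ?m = "(- 1 :: complex)"
    have m1: "?m \<odot>\<^bsub>A\<^esub> w = \<ominus>\<^bsub>A\<^esub> w" if w: "w \<in> carrier A" for w
    proof -
      have "?m \<odot>\<^bsub>A\<^esub> w \<oplus>\<^bsub>A\<^esub> w = (?m + 1) \<odot>\<^bsub>A\<^esub> w"
        using V.smult_l_distr[of ?m 1 w] V.smult_one[of w] w
        by (simp add: ring_of_type_algebra_def)
      also have "cnorm A \<dots> = 0"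
        using cnorm_smult[OF w, of 0] by simp
      then have "(?m + 1) \<odot>\<^bsub>A\<^esub> w = \<zero>\<^bsub>A\<^esub>"
        using cnorm_eq_0 V.smult_closed[of "?m + 1" w] w by (simp add: ring_of_type_algebra_def)
      finally show ?thesis
        using A.minus_equality[of "?m \<odot>\<^bsub>A\<^esub> w" w] V.smult_closed[of ?m w] w
        by (simp add: ring_of_type_algebra_def)
    qed
    have "y \<ominus>\<^bsub>A\<^esub> x = \<ominus>\<^bsub>A\<^esub> (x \<ominus>\<^bsub>A\<^esub> y)"
      using True by (simp add: A.minus_eq A.minus_add A.a_comm)
    also have "\<dots> = ?m \<odot>\<^bsub>A\<^esub> (x \<ominus>\<^bsub>A\<^esub> y)"
      using True by (simp add: m1)
    finally show ?thesis
      using True by (simp add: cdist_def cnorm_smult)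
  qed (auto simp: cdist_def)
next
  fix x y assume "x \<in> carrier A" "y \<in> carrier A"
  then show "cdist A x y = 0 \<longleftrightarrow> x = y"
    by (simp add: cdist_def cnorm_eq_0 A.r_right_minus_eq)
next
  fix x y z assume *: "x \<in> carrier A" "y \<in> carrier A" "z \<in> carrier A"
  then have "x \<ominus>\<^bsub>A\<^esub> z = (x \<ominus>\<^bsub>A\<^esub> y) \<oplus>\<^bsub>A\<^esub> (y \<ominus>\<^bsub>A\<^esub> z)"
    by (simp add: A.minus_eq A.a_assoc A.r_neg1)
  then show "cdist A x z \<le> cdist A x y + cdist A y z"
    using * cnorm_add[of "x \<ominus>\<^bsub>A\<^esub> y" "y \<ominus>\<^bsub>A\<^esub> z"] by (simp add: cdist_def)
qed

definition clinear_map :: "'a cstar \<Rightarrow> 'b cstar \<Rightarrow> ('a \<Rightarrow> 'b) \<Rightarrow> bool" where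
  "clinear_map A B f \<longleftrightarrow>
     f \<in> carrier A \<rightarrow> carrier B \<and>
     (\<forall>x\<in>carrier A. \<forall>y\<in>carrier A. f (x \<oplus>\<^bsub>A\<^esub> y) = f x \<oplus>\<^bsub>B\<^esub> f y) \<and>
     (\<forall>c. \<forall>x\<in>carrier A. f (c \<odot>\<^bsub>A\<^esub> x) = c \<odot>\<^bsub>B\<^esub> f x)"

definition star_hom :: "'a cstar \<Rightarrow> 'b cstar \<Rightarrow> ('a \<Rightarrow> 'b) \<Rightarrow> bool" where
  "star_hom A B f \<longleftrightarrow>
     f \<in> ring_hom A B \<and> clinear_map A B f \<and> (\<forall>x\<in>carrier A. f (adj A x) = adj B (f x))"

definition cstar_subalgebra :: "'a cstar \<Rightarrow> 'a set \<Rightarrow> bool" where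
  "cstar_subalgebra A S \<longleftrightarrow>
     S \<subseteq> carrier A \<and> \<one>\<^bsub>A\<^esub> \<in> S \<and>
     (\<forall>x\<in>S. \<forall>y\<in>S. x \<oplus>\<^bsub>A\<^esub> y \<in> S \<and> x \<otimes>\<^bsub>A\<^esub> y \<in> S) \<and>
     (\<forall>c. \<forall>x\<in>S. c \<odot>\<^bsub>A\<^esub> x \<in> S) \<and> (\<forall>x\<in>S. adj A x \<in> S) \<and>
     closedin (ctop A) S"

definition cstar_generated_by :: "'a cstar \<Rightarrow> 'a set \<Rightarrow> bool" where
  "cstar_generated_by A G \<longleftrightarrow>
     G \<subseteq> carrier A \<and> (\<forall>S. cstar_subalgebra A S \<and> G \<subseteq> S \<longrightarrow> S = carrier A)"

definition state :: "'a cstar \<Rightarrow> ('a \<Rightarrow> complex) \<Rightarrow> bool" where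
  "state A h \<longleftrightarrow>
     (\<forall>x\<in>carrier A. \<forall>y\<in>carrier A. h (x \<oplus>\<^bsub>A\<^esub> y) = h x + h y) \<and>
     (\<forall>c. \<forall>x\<in>carrier A. h (c \<odot>\<^bsub>A\<^esub> x) = c * h x) \<and>
     (\<forall>x\<in>carrier A. h (adj A x \<otimes>\<^bsub>A\<^esub> x) \<in> \<real>\<^sub>\<ge>\<^sub>0) \<and>
     h \<one>\<^bsub>A\<^esub> = 1"


section \<open>Magic unitaries and the universal algebra they generate\<close>

definition projection :: "'a cstar \<Rightarrow> 'a \<Rightarrow> bool" where
  "projection A p \<longleftrightarrow> p \<in> carrier A \<and> adj A p = p \<and> p \<otimes>\<^bsub>A\<^esub> p = p"

definition magic_unitary :: "nat \<Rightarrow> 'a cstar \<Rightarrow> (nat \<Rightarrow> nat \<Rightarrow> 'a) \<Rightarrow> bool" where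
  "magic_unitary n A u \<longleftrightarrow>
     (\<forall>i\<in>{1..n}. \<forall>j\<in>{1..n}. projection A (u i j)) \<and>
     (\<forall>i\<in>{1..n}. \<forall>j\<in>{1..n}. \<forall>k\<in>{1..n}. j \<noteq> k \<longrightarrow>
        u i j \<otimes>\<^bsub>A\<^esub> u i k = \<zero>\<^bsub>A\<^esub> \<and> u j i \<otimes>\<^bsub>A\<^esub> u k i = \<zero>\<^bsub>A\<^esub>) \<and>
     (\<forall>i\<in>{1..n}. (\<Oplus>\<^bsub>A\<^esub>j\<in>{1..n}. u i j) = \<one>\<^bsub>A\<^esub> \<and> (\<Oplus>\<^bsub>A\<^esub>j\<in>{1..n}. u j i) = \<one>\<^bsub>A\<^esub>)"

text \<open>
  The universal C*-algebra \<open>A\<^sub>s(n)\<close> with its generators \<open>u\<close>. A formula of HOL cannot quantify over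
  types, so the test algebras \<open>B\<close> range over all C*-algebras whose carrier is a set of infinite
  complex matrices. This loses no generality: only the C*-subalgebra generated by \<open>v\<close> matters, it is
  separable, and a separable C*-algebra is isomorphic to an algebra of operators on
  \<open>\<ell>\<^sup>2(\<nat>)\<close>, i.e. of infinite matrices. (The carrier only serves as a supply of names; the operations
  of \<open>B\<close> are arbitrary.) The homomorphism \<open>f\<close> is unique since \<open>A\<close> is generated by the \<open>u i j\<close>.\<close>

definition quantum_permutation_algebra ::
    "nat \<Rightarrow> 'a cstar \<Rightarrow> (nat \<Rightarrow> nat \<Rightarrow> 'a) \<Rightarrow> bool" where
  "quantum_permutation_algebra n A u \<longleftrightarrow>
     cstar_algebra A \<and> magic_unitary n A u \<and>
     cstar_generated_by A {u i j |i j. i \<in> {1..n} \<and> j \<in> {1..n}} \<and>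
     (\<forall>(B :: (nat \<Rightarrow> nat \<Rightarrow> complex) cstar) v. cstar_algebra B \<and> magic_unitary n B v \<longrightarrow>
        (\<exists>f. star_hom A B f \<and> (\<forall>i\<in>{1..n}. \<forall>j\<in>{1..n}. f (u i j) = v i j)))"


section \<open>Minimal tensor products\<close>

definition tsum ::
    "'t cstar \<Rightarrow> ('a \<Rightarrow> 'b \<Rightarrow> 't) \<Rightarrow> nat \<Rightarrow> (nat \<Rightarrow> 'a) \<Rightarrow> (nat \<Rightarrow> 'b) \<Rightarrow> 't" where
  "tsum T ten m a b = (\<Oplus>\<^bsub>T\<^esub>i\<in>{..<m}. ten (a i) (b i))"

definition clin_indep :: "'a cstar \<Rightarrow> nat \<Rightarrow> (nat \<Rightarrow> 'a) \<Rightarrow> bool" where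
  "clin_indep A m b \<longleftrightarrow>
     (\<forall>c. (\<Oplus>\<^bsub>A\<^esub>i\<in>{..<m}. c i \<odot>\<^bsub>A\<^esub> b i) = \<zero>\<^bsub>A\<^esub> \<longrightarrow> (\<forall>i<m. c i = 0))"

text \<open>\<open>T\<close> is the completion of the algebraic tensor product of \<open>A\<close> and \<open>B\<close> in some C*-norm, where
  \<open>ten a b\<close> is the elementary tensor. The clause on linearly independent families says
  that the algebraic tensor product embeds into \<open>T\<close>.\<close>

definition tensor_completion ::
    "'a cstar \<Rightarrow> 'b cstar \<Rightarrow> 't cstar \<Rightarrow> ('a \<Rightarrow> 'b \<Rightarrow> 't) \<Rightarrow> bool" where
  "tensor_completion A B T ten \<longleftrightarrow>
     cstar_algebra A \<and> cstar_algebra B \<and> cstar_algebra T \<and>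
     (\<forall>a\<in>carrier A. clinear_map B T (ten a)) \<and>
     (\<forall>b\<in>carrier B. clinear_map A T (\<lambda>a. ten a b)) \<and>
     (\<forall>a\<in>carrier A. \<forall>a'\<in>carrier A. \<forall>b\<in>carrier B. \<forall>b'\<in>carrier B.
        ten a b \<otimes>\<^bsub>T\<^esub> ten a' b' = ten (a \<otimes>\<^bsub>A\<^esub> a') (b \<otimes>\<^bsub>B\<^esub> b')) \<and>
     (\<forall>a\<in>carrier A. \<forall>b\<in>carrier B. adj T (ten a b) = ten (adj A a) (adj B b)) \<and>
     ten \<one>\<^bsub>A\<^esub> \<one>\<^bsub>B\<^esub> = \<one>\<^bsub>T\<^esub> \<and>
     (\<forall>m. \<forall>a\<in>{..<m} \<rightarrow> carrier A. \<forall>b\<in>{..<m} \<rightarrow> carrier B.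
        clin_indep B m b \<and> tsum T ten m a b = \<zero>\<^bsub>T\<^esub> \<longrightarrow> (\<forall>i<m. a i = \<zero>\<^bsub>A\<^esub>)) \<and>
     ctop T closure_of {tsum T ten m a b |m a b.
        a \<in> {..<m} \<rightarrow> carrier A \<and> b \<in> {..<m} \<rightarrow> carrier B} = carrier T"

text \<open>The minimal (spatial) tensor product is the completion in the least C*-norm. Testing against
  completions of the same type as \<open>T\<close> suffices: the least norm gives the smallest completion, which
  therefore fits into any type that accommodates some completion.\<close>

definition min_tensor_product ::
    "'a cstar \<Rightarrow> 'b cstar \<Rightarrow> 't cstar \<Rightarrow> ('a \<Rightarrow> 'b \<Rightarrow> 't) \<Rightarrow> bool" where
  "min_tensor_product A B T ten \<longleftrightarrow>
     tensor_completion A B T ten \<and>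
     (\<forall>(T' :: 't cstar) ten'. tensor_completion A B T' ten' \<longrightarrow>
        (\<forall>m. \<forall>a\<in>{..<m} \<rightarrow> carrier A. \<forall>b\<in>{..<m} \<rightarrow> carrier B.
           cnorm T (tsum T ten m a b) \<le> cnorm T' (tsum T' ten' m a b)))"

text \<open>The slice maps \<open>h \<otimes> id\<close> and \<open>id \<otimes> h\<close>; by density of the algebraic tensor
  product they are determined on \<open>carrier T\<close> by these conditions.\<close>

definition slice_left ::
    "'a cstar \<Rightarrow> 'b cstar \<Rightarrow> 't cstar \<Rightarrow> ('a \<Rightarrow> 'b \<Rightarrow> 't) \<Rightarrow> ('a \<Rightarrow> complex) \<Rightarrow> ('t \<Rightarrow> 'b) \<Rightarrow> bool" where
  "slice_left A B T ten h F \<longleftrightarrow>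
     clinear_map T B F \<and> continuous_map (ctop T) (ctop B) F \<and>
     (\<forall>a\<in>carrier A. \<forall>b\<in>carrier B. F (ten a b) = h a \<odot>\<^bsub>B\<^esub> b)"

definition slice_right ::
    "'a cstar \<Rightarrow> 'b cstar \<Rightarrow> 't cstar \<Rightarrow> ('a \<Rightarrow> 'b \<Rightarrow> 't) \<Rightarrow> ('b \<Rightarrow> complex) \<Rightarrow> ('t \<Rightarrow> 'a) \<Rightarrow> bool" where
  "slice_right A B T ten h F \<longleftrightarrow>
     clinear_map T A F \<and> continuous_map (ctop T) (ctop A) F \<and>
     (\<forall>a\<in>carrier A. \<forall>b\<in>carrier B. F (ten a b) = h b \<odot>\<^bsub>A\<^esub> a)"


section \<open>Comultiplication and Haar functional\<close>

definition comultiplication ::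
    "nat \<Rightarrow> 'a cstar \<Rightarrow> (nat \<Rightarrow> nat \<Rightarrow> 'a) \<Rightarrow> 't cstar \<Rightarrow> ('a \<Rightarrow> 'a \<Rightarrow> 't) \<Rightarrow> ('a \<Rightarrow> 't) \<Rightarrow> bool" where
  "comultiplication n A u T ten \<Delta> \<longleftrightarrow>
     star_hom A T \<Delta> \<and>
     (\<forall>i\<in>{1..n}. \<forall>j\<in>{1..n}. \<Delta> (u i j) = (\<Oplus>\<^bsub>T\<^esub>k\<in>{1..n}. ten (u i k) (u k j)))"

definition haar_functional ::
    "'a cstar \<Rightarrow> 't cstar \<Rightarrow> ('a \<Rightarrow> 'a \<Rightarrow> 't) \<Rightarrow> ('a \<Rightarrow> 't) \<Rightarrow> ('a \<Rightarrow> complex) \<Rightarrow> bool" where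
  "haar_functional A T ten \<Delta> h \<longleftrightarrow>
     state A h \<and>
     (\<exists>F. slice_left A A T ten h F \<and> (\<forall>a\<in>carrier A. F (\<Delta> a) = h a \<odot>\<^bsub>A\<^esub> \<one>\<^bsub>A\<^esub>)) \<and>
     (\<exists>F. slice_right A A T ten h F \<and> (\<forall>a\<in>carrier A. F (\<Delta> a) = h a \<odot>\<^bsub>A\<^esub> \<one>\<^bsub>A\<^esub>))"


section \<open>Laws\<close>

definition is_law :: "'a cstar \<Rightarrow> ('a \<Rightarrow> complex) \<Rightarrow> 'a \<Rightarrow> real measure \<Rightarrow> bool" where
  "is_law A h a \<mu> \<longleftrightarrow>
     real_distribution \<mu> \<and>
     (\<exists>K. compact K \<and> (AE x in \<mu>. x \<in> K)) \<and>
     (\<forall>k::nat. complex_of_real (\<integral>x. x ^ k \<partial>\<mu>) = h (a [^]\<^bsub>A\<^esub> k))"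

definition law :: "'a cstar \<Rightarrow> ('a \<Rightarrow> complex) \<Rightarrow> 'a \<Rightarrow> real measure" where
  "law A h a = (THE \<mu>. is_law A h a \<mu>)"

lemma is_law_char_sums:
  assumes "is_law A h a \<mu>"
  shows "(\<lambda>k. (\<i> * complex_of_real t) ^ k / fact k * h (a [^]\<^bsub>A\<^esub> k)) sums char \<mu> t"
proof -
  interpret real_distribution \<mu>
    using assms by (simp add: is_law_def)
  obtain K where K: "compact K" "AE x in \<mu>. x \<in> K"
    using assms by (auto simp: is_law_def)
  obtain r where r: "r > 0" "\<And>x. x \<in> K \<Longrightarrow> norm x \<le> r"
    using compact_imp_bounded[OF K(1)] bounded_pos by blast
  have AE_r: "AE x in \<mu>. \<bar>x\<bar> ^ n \<le> r ^ n" for n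
    using K(2) by eventually_elim (use r in \<open>auto intro!: power_mono\<close>)
  have int_abs: "integrable \<mu> (\<lambda>x. \<bar>x\<bar> ^ n)" and int: "integrable \<mu> (\<lambda>x. x ^ n)" for n
    by (rule integrable_const_bound[of _ "r ^ n"]; use AE_r[of n] in \<open>simp add: power_abs\<close>)+
  have exp_le: "expectation (\<lambda>x. \<bar>x\<bar> ^ n) \<le> r ^ n" for n
    using integral_mono_AE[OF int_abs[of n] integrable_const AE_r[of n]] prob_space by simp
  define S where
    "S n = (\<Sum>k\<le>n. (\<i> * complex_of_real t) ^ k / fact k * h (a [^]\<^bsub>A\<^esub> k))" for n
  have "cmod (S n - char \<mu> t) \<le> 2 * ((\<bar>t\<bar> * r) ^ n / fact n)" for n
  proof -
    have "S n = (\<Sum>k\<le>n. (\<i> * t) ^ k / fact k * expectation (\<lambda>x. x ^ k))"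
      using assms by (simp add: S_def is_law_def)
    then have "cmod (S n - char \<mu> t) \<le> (2 * \<bar>t\<bar> ^ n / fact n) * expectation (\<lambda>x. \<bar>x\<bar> ^ n)"
      using char_approx1[of n t, OF int] by (simp add: norm_minus_commute)
    also have "\<dots> \<le> (2 * \<bar>t\<bar> ^ n / fact n) * r ^ n"
      by (intro mult_left_mono exp_le) auto
    finally show ?thesis
      by (simp add: power_mult_distrib)
  qed
  moreover have "(\<lambda>n. 2 * ((\<bar>t\<bar> * r) ^ n / fact n)) \<longlonglongrightarrow> 0"
    using summable_LIMSEQ_zero[OF summable_exp[of "\<bar>t\<bar> * r"]]
    by (intro tendsto_mult_right_zero) (simp add: inverse_eq_divide)
  ultimately have "(\<lambda>n. S n - char \<mu> t) \<longlonglongrightarrow> 0"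
    by (rule Lim_null_comparison[OF always_eventually[OF allI]])
  then have "S \<longlonglongrightarrow> char \<mu> t"
    by (rule LIM_zero_cancel)
  then show ?thesis
    unfolding sums_def_le S_def .
qed

lemma is_law_unique:
  assumes \<mu>: "is_law A h a \<mu>" and \<nu>: "is_law A h a \<nu>"
  shows "\<mu> = \<nu>"
proof (rule Levy_uniqueness)
  show "char \<mu> = char \<nu>"
    using sums_unique2[OF is_law_char_sums[OF \<mu>] is_law_char_sums[OF \<nu>]] by (rule ext)
qed (use \<mu> \<nu> in \<open>simp_all add: is_law_def\<close>)

lemma law_eqI: "is_law A h a \<mu> \<Longrightarrow> law A h a = \<mu>"
  unfolding law_def by (blast intro: is_law_unique)


section \<open>The limiting measures\<close>

definition mixture :: "real \<Rightarrow> 'a measure \<Rightarrow> 'a measure \<Rightarrow> 'a measure" where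
  "mixture p M N = measure_of (space M) (sets M)
     (\<lambda>E. ennreal (1 - p) * emeasure M E + ennreal p * emeasure N E)"

definition lambda1 :: "real measure" where
  "lambda1 = density lborel (indicator {0..1})"

definition nu1 :: "real measure" where
  "nu1 = density lborel
     (\<lambda>x. ennreal (2 / pi * sqrt (inverse x - 1)) * indicator {0..1} x)"

definition mu :: "nat \<Rightarrow> real measure" where
  "mu s = (if s = 1 then return borel 1 else if s = 2 then lambda1 else nu1)"

end

theory Submission
  imports Defs
begin

no_notation fps_nth (infixl "$" 75)

text \<open>Invariance of the Haar functional \<open>h\<close> is tested against a one-parameter family \<open>\<pi> t\<close> of
  representations on \<open>\<complex>\<^sup>2\<close>, given by two projections onto lines at angles \<open>t\<close> and \<open>- t\<close>.
  The first-order term at \<open>t = 0\<close> of \<open>h = (h \<otimes> \<pi> t) \<circ> \<Delta>\<close> says that \<open>h\<close> is invariant under the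
  column swap \<open>\<tau> = (1 2)(3 4)\<close> and vanishes on the image of a \<open>\<tau>\<close>-twisted derivation \<open>\<delta>\<close>.
  Put \<open>D = u\<^sub>1\<^sub>1 + u\<^sub>2\<^sub>2 + u\<^sub>3\<^sub>3 + u\<^sub>4\<^sub>4\<close>, \<open>E = u\<^sub>1\<^sub>1 + u\<^sub>2\<^sub>2 - u\<^sub>3\<^sub>3 - u\<^sub>4\<^sub>4\<close> and
  \<open>Z = u\<^sub>1\<^sub>1 + u\<^sub>1\<^sub>2 + u\<^sub>2\<^sub>1 + u\<^sub>2\<^sub>2\<close>. Then \<open>Z\<close> is central in the algebra generated by the three,
  \<open>D + \<tau> D = 2 Z\<close>, \<open>E D = (\<tau> D) E\<close>, \<open>E\<^sup>2 = D (\<tau> D)\<close>, \<open>\<delta> D = 2 E\<close>, \<open>\<delta> E = D - \<tau> D\<close>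
  and \<open>\<delta> Z = 0\<close>, so that \<open>h (\<delta> (E D\<^sup>k Z\<^sup>n)) = 0\<close> becomes
  \<open>(2 k + 1) h (D\<^sup>k Z\<^sup>n\<^sup>+\<^sup>1) = (k + 1) h (D\<^sup>k\<^sup>+\<^sup>1 Z\<^sup>n)\<close>. Relabelling the four points gives the same with the
  swaps \<open>(1 3)(2 4)\<close> and \<open>(1 4)(2 3)\<close>, and as all entries of \<open>u\<close> sum up to \<open>4\<close> this yields
  \<open>(k + 2) h (D\<^sup>k\<^sup>+\<^sup>1) = 2 (2 k + 1) h (D\<^sup>k)\<close>, the recursion of the Catalan numbers, and then
  \<open>h (Z\<^sup>n) = 2\<^sup>n / (n + 1)\<close>. Finally \<open>(u\<^sub>1\<^sub>1 + u\<^sub>2\<^sub>2)\<^sup>n\<^sup>+\<^sup>1 = Z\<^sup>n (u\<^sub>1\<^sub>1 + u\<^sub>2\<^sub>2)\<close> settles \<open>s = 2\<close>.\<close>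

section \<open>Matrix algebras\<close>

definition mat_adj :: "complex^'n^'m \<Rightarrow> complex^'m^'n" where
  "mat_adj P = (\<chi> i j. cnj (P $ j $ i))"

definition mat_norm :: "complex^'n^'m \<Rightarrow> real" where
  "mat_norm P = onorm ((*v) P)"

text \<open>\<open>from_nat\<close> enumerates the finite index type, with repetitions; all that matters is that
  \<open>mat_code\<close> is injective, so that it names the matrices within the type over which the test
  algebras of \<open>quantum_permutation_algebra\<close> range.\<close>

definition mat_code :: "complex^'n^'n \<Rightarrow> nat \<Rightarrow> nat \<Rightarrow> complex" where
  "mat_code P = (\<lambda>i j. P $ from_nat i $ from_nat j)"

definition mat_decode :: "(nat \<Rightarrow> nat \<Rightarrow> complex) \<Rightarrow> complex^'n^'n" where
  "mat_decode x = (\<chi> i j. x (to_nat i) (to_nat j))"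

lemma mat_decode_code [simp]: "mat_decode (mat_code P) = P"
  by (simp add: mat_decode_def mat_code_def vec_eq_iff)

text \<open>All operations are transported along \<open>mat_code\<close>; the argument only fixes
  the size of the matrices.\<close>

definition mat_cstar :: "'n::finite itself \<Rightarrow> (nat \<Rightarrow> nat \<Rightarrow> complex) cstar" where
  "mat_cstar _ =
     \<lparr>carrier = range (mat_code :: complex^'n^'n \<Rightarrow> _),
      monoid.mult = (\<lambda>x y. mat_code (mat_decode x ** mat_decode y :: complex^'n^'n)),
      one = mat_code (mat 1 :: complex^'n^'n),
      ring.zero = mat_code (0 :: complex^'n^'n),
      add = (\<lambda>x y. mat_code (mat_decode x + mat_decode y :: complex^'n^'n)),
      module.smult = (\<lambda>c x. mat_code (\<chi> i j. c * (mat_decode x :: complex^'n^'n) $ i $ j)),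
      adj = (\<lambda>x. mat_code (mat_adj (mat_decode x :: complex^'n^'n))),
      cnorm = (\<lambda>x. mat_norm (mat_decode x :: complex^'n^'n))\<rparr>"

text \<open>The norm of the type \<open>complex^'n^'m\<close> is the Frobenius norm, so this is
  Cauchy-Schwarz in each row.\<close>

lemma norm_matrix_vector_mult_le: "norm (P *v v) \<le> norm P * norm v"
  for P :: "complex^'n^'m"
proof -
  have "norm (P *v v) = L2_set (\<lambda>i. norm ((P *v v) $ i)) UNIV"
    by (simp add: norm_vec_def)
  also have "\<dots> \<le> L2_set (\<lambda>i. norm (P $ i) * norm v) UNIV"
  proof (rule L2_set_mono)
    fix i
    have "norm ((P *v v) $ i) \<le> (\<Sum>j\<in>UNIV. \<bar>norm (P $ i $ j)\<bar> * \<bar>norm (v $ j)\<bar>)"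
      unfolding matrix_vector_mult_def by (simp add: sum_norm_le norm_mult)
    also have "\<dots> \<le> norm (P $ i) * norm v"
      unfolding norm_vec_def by (rule L2_set_mult_ineq)
    finally show "norm ((P *v v) $ i) \<le> norm (P $ i) * norm v" .
  qed simp
  also have "\<dots> = norm P * norm v"
    by (simp add: norm_vec_def L2_set_left_distrib)
  finally show ?thesis .
qed

lemma norm_matrix_vector_mult_le_mat_norm: "norm (P *v v) \<le> mat_norm P * norm v"
  for P :: "complex^'n^'m"
  unfolding mat_norm_def by (rule onorm) simp

lemma mat_norm_bound: "(\<And>v. norm (P *v v) \<le> b * norm v) \<Longrightarrow> mat_norm P \<le> b"
  for P :: "complex^'n^'m"
  unfolding mat_norm_def by (rule onorm_le)

lemma mat_norm_nonneg: "0 \<le> mat_norm P" for P :: "complex^'n^'m"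
  unfolding mat_norm_def by (rule onorm_pos_le) simp

lemma mat_norm_le_norm: "mat_norm P \<le> norm P" for P :: "complex^'n^'m"
  by (rule mat_norm_bound) (rule norm_matrix_vector_mult_le)

text \<open>Every entry is a coordinate of the image of a unit vector. Together with
  \<open>mat_norm_le_norm\<close> this makes the operator norm equivalent to the Frobenius norm; a
  crude constant is enough for completeness.\<close>

lemma norm_le_mat_norm: "norm P \<le> real CARD('m) * real CARD('n) * mat_norm P"
  for P :: "complex^'n^'m"
proof -
  have entry: "norm (P $ i $ j) \<le> mat_norm P" for i j
  proof -
    have "norm (P $ i $ j) = norm ((P *v axis j 1) $ i)"
      by (simp add: matrix_vector_mult_def axis_def if_distrib cong: if_cong)
    also have "\<dots> \<le> norm (P *v axis j 1)"
      by (rule Finite_Cartesian_Product.norm_nth_le)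
    also have "\<dots> \<le> mat_norm P * norm (axis j 1 :: complex^'n)"
      by (rule norm_matrix_vector_mult_le_mat_norm)
    finally show ?thesis by (simp add: norm_axis_1)
  qed
  have "norm P \<le> (\<Sum>i\<in>UNIV. norm (P $ i))"
    unfolding norm_vec_def[of P] by (rule L2_set_le_sum) simp
  also have "\<dots> \<le> (\<Sum>i\<in>UNIV. \<Sum>j\<in>UNIV. norm (P $ i $ j))"
    by (intro sum_mono) (simp add: norm_vec_def L2_set_le_sum)
  also have "\<dots> \<le> (\<Sum>i\<in>(UNIV :: 'm set). \<Sum>j\<in>(UNIV :: 'n set). mat_norm P)"
    by (intro sum_mono entry)
  finally show ?thesis by simp
qed

lemma mat_norm_eq_0: "mat_norm P = 0 \<longleftrightarrow> P = 0" for P :: "complex^'n^'m"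
  using norm_le_mat_norm[of P] mat_norm_le_norm[of P] mat_norm_nonneg[of P] by auto

lemma mat_norm_add: "mat_norm (P + Q) \<le> mat_norm P + mat_norm Q" for P :: "complex^'n^'m"
proof (rule mat_norm_bound)
  fix v
  have "norm ((P + Q) *v v) \<le> norm (P *v v) + norm (Q *v v)"
    by (simp add: matrix_vector_mult_add_rdistrib norm_triangle_ineq)
  then show "norm ((P + Q) *v v) \<le> (mat_norm P + mat_norm Q) * norm v"
    using norm_matrix_vector_mult_le_mat_norm[of P v] norm_matrix_vector_mult_le_mat_norm[of Q v]
    by (simp add: algebra_simps)
qed

lemma mat_norm_mult: "mat_norm (P ** Q) \<le> mat_norm P * mat_norm Q"
  for P :: "complex^'n^'m"
proof (rule mat_norm_bound)
  fix v
  have "norm ((P ** Q) *v v) \<le> mat_norm P * norm (Q *v v)"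
    by (simp add: norm_matrix_vector_mult_le_mat_norm flip: matrix_vector_mul_assoc)
  also have "\<dots> \<le> mat_norm P * (mat_norm Q * norm v)"
    by (intro mult_left_mono norm_matrix_vector_mult_le_mat_norm mat_norm_nonneg)
  finally show "norm ((P ** Q) *v v) \<le> mat_norm P * mat_norm Q * norm v"
    by simp
qed

lemma mat_norm_smult: "mat_norm (\<chi> i j. c * P $ i $ j) = cmod c * mat_norm P"
  for P :: "complex^'n^'m"
proof -
  have le: "mat_norm (\<chi> i j. d * Q $ i $ j) \<le> cmod d * mat_norm Q" for d and Q :: "complex^'n^'m"
  proof (rule mat_norm_bound)
    fix v
    have "(\<chi> i j. d * Q $ i $ j) *v v = (\<chi> i. d * (Q *v v) $ i)"
      by (simp add: vec_eq_iff matrix_vector_mult_def sum_distrib_left mult.assoc)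
    moreover have "norm (\<chi> i. d * (Q *v v) $ i) = cmod d * norm (Q *v v)"
      by (simp add: norm_vec_def norm_mult L2_set_right_distrib)
    ultimately show "norm ((\<chi> i j. d * Q $ i $ j) *v v) \<le> cmod d * mat_norm Q * norm v"
      using mult_left_mono[OF norm_matrix_vector_mult_le_mat_norm[of Q v], of "cmod d"]
      by (simp add: mult.assoc)
  qed
  show ?thesis
  proof (cases "c = 0")
    case True
    have "(\<chi> i j. 0) = (0 :: complex^'n^'m)"
      by (simp add: vec_eq_iff)
    then show ?thesis using True by (simp add: mat_norm_eq_0)
  next
    case False
    \<comment> \<open>The reverse inequality is \<open>le\<close> for the scalar
      \<open>inverse c\<close>.\<close>
    have "P = (\<chi> i j. inverse c * (\<chi> i j. c * P $ i $ j) $ i $ j)"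
      using False by (simp add: vec_eq_iff)
    then have "mat_norm P \<le> cmod (inverse c) * mat_norm (\<chi> i j. c * P $ i $ j)"
      using le[of "inverse c" "\<chi> i j. c * P $ i $ j"] by simp
    then have "cmod c * mat_norm P \<le> mat_norm (\<chi> i j. c * P $ i $ j)"
      using False by (simp add: norm_divide inverse_eq_divide pos_le_divide_eq mult.commute)
    then show ?thesis using le[of c P] by simp
  qed
qed

section \<open>Adjoints of matrices and the C*-identity\<close>

lemma mat_adj_adj: "mat_adj (mat_adj P) = P"
  by (simp add: mat_adj_def vec_eq_iff)

lemma matrix_add_rdistrib: "(P + Q) ** R = P ** R + Q ** R" for P :: "'a::semiring_1^'n^'m"
  by (simp add: matrix_matrix_mult_def vec_eq_iff sum.distrib distrib_right)

lemma mat_adj_mult: "mat_adj (P ** Q) = mat_adj Q ** mat_adj P"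
  by (simp add: mat_adj_def matrix_matrix_mult_def vec_eq_iff mult.commute)

lemma mat_adj_add: "mat_adj (P + Q) = mat_adj P + mat_adj Q"
  by (simp add: mat_adj_def vec_eq_iff)

lemma mat_adj_smult: "mat_adj (\<chi> i j. c * P $ i $ j) = (\<chi> i j. cnj c * mat_adj P $ i $ j)"
  by (simp add: mat_adj_def vec_eq_iff)

lemma matrix_smult_mult_left: "(\<chi> i j. c * P $ i $ j) ** Q = (\<chi> i j. c * (P ** Q) $ i $ j)"
  for P :: "complex^'n^'m"
  by (simp add: matrix_matrix_mult_def vec_eq_iff sum_distrib_left mult.assoc)

lemma matrix_smult_mult_right: "P ** (\<chi> i j. c * Q $ i $ j) = (\<chi> i j. c * (P ** Q) $ i $ j)"
  for P :: "complex^'n^'m"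
  by (simp add: matrix_matrix_mult_def vec_eq_iff sum_distrib_left mult.left_commute)

text \<open>The inner product of the type is the real part of the Hermitian form; the usual
  adjunction survives taking real parts.\<close>

lemma inner_mat_adj: "(P *v v) \<bullet> w = v \<bullet> (mat_adj P *v w)" for P :: "complex^'n^'m"
proof -
  have inner: "x \<bullet> y = Re (x * cnj y)" for x y :: complex
    by (simp add: inner_complex_def)
  have "(P *v v) \<bullet> w = Re (\<Sum>i\<in>UNIV. \<Sum>j\<in>UNIV. P $ i $ j * v $ j * cnj (w $ i))"
    by (simp only: inner_vec_def inner Re_sum[symmetric] matrix_vector_mult_def
        vec_lambda_beta sum_distrib_right)
  also have "\<dots> = Re (\<Sum>j\<in>UNIV. \<Sum>i\<in>UNIV. P $ i $ j * v $ j * cnj (w $ i))"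
    by (subst sum.swap) (rule refl)
  also have "\<dots> = v \<bullet> (mat_adj P *v w)"
    by (simp add: inner_vec_def inner matrix_vector_mult_def mat_adj_def sum_distrib_left
        mult.assoc mult.left_commute del: times_complex.simps)
  finally show ?thesis .
qed

lemma mat_norm_cstar: "mat_norm (mat_adj P ** P) = (mat_norm P)\<^sup>2" for P :: "complex^'n^'m"
proof -
  have sq: "(mat_norm Q)\<^sup>2 \<le> mat_norm (mat_adj Q ** Q)" for Q :: "complex^'p^'q"
  proof -
    have "mat_norm Q \<le> sqrt (mat_norm (mat_adj Q ** Q))"
    proof (rule mat_norm_bound)
      fix v
      have "(norm (Q *v v))\<^sup>2 = v \<bullet> (mat_adj Q ** Q *v v)"
        by (simp add: power2_norm_eq_inner inner_mat_adj flip: matrix_vector_mul_assoc)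
      also have "\<dots> \<le> norm v * (mat_norm (mat_adj Q ** Q) * norm v)"
        by (intro order_trans[OF norm_cauchy_schwarz] mult_left_mono
            norm_matrix_vector_mult_le_mat_norm) simp
      finally have "(norm (Q *v v))\<^sup>2 \<le> mat_norm (mat_adj Q ** Q) * (norm v)\<^sup>2"
        by (simp add: power2_eq_square mult.left_commute)
      then have "sqrt ((norm (Q *v v))\<^sup>2) \<le> sqrt (mat_norm (mat_adj Q ** Q) * (norm v)\<^sup>2)"
        by (rule real_sqrt_le_mono)
      then show "norm (Q *v v) \<le> sqrt (mat_norm (mat_adj Q ** Q)) * norm v"
        by (simp add: real_sqrt_mult)
    qed
    from power_mono[OF this mat_norm_nonneg, of 2] show ?thesis
      by (simp add: mat_norm_nonneg)
  qed
  \<comment> \<open>Cancel one factor in ||Q||^2 \<le> ||Q* Q|| \<le> ||Q*|| ||Q||. Used for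
    \<open>P\<close> and for its adjoint, this shows that both have the same norm.\<close>
  have adj_le: "mat_norm Q \<le> mat_norm (mat_adj Q)" for Q :: "complex^'p^'q"
  proof (cases "mat_norm Q = 0")
    case False
    have "mat_norm Q * mat_norm Q \<le> mat_norm (mat_adj Q) * mat_norm Q"
      using order_trans[OF sq[of Q] mat_norm_mult] by (simp add: power2_eq_square)
    then show ?thesis using False mat_norm_nonneg[of Q] by simp
  qed (simp add: mat_norm_nonneg)
  have "mat_norm (mat_adj P) = mat_norm P"
    using adj_le[of P] adj_le[of "mat_adj P"] by (simp add: mat_adj_adj)
  then show ?thesis
    using sq[of P] mat_norm_mult[of "mat_adj P" P] by (simp add: power2_eq_square)
qed

text \<open>Completeness comes from the equivalence of norms: a Cauchy sequence for the operator
  norm converges for the Frobenius norm, hence also for the operator norm.\<close>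

lemma cstar_algebra_mat: "cstar_algebra (mat_cstar TYPE('n::finite))"
proof -
  let ?M = "mat_cstar TYPE('n)"
  have grp: "abelian_group ?M"
  proof (rule abelian_groupI)
    fix x assume "x \<in> carrier ?M"
    then show "\<exists>y\<in>carrier ?M. y \<oplus>\<^bsub>?M\<^esub> x = \<zero>\<^bsub>?M\<^esub>"
      by (intro bexI[of _ "mat_code (- mat_decode x :: complex^'n^'n)"]) (auto simp: mat_cstar_def)
  qed (auto simp: mat_cstar_def add_ac)
  have mon: "monoid ?M"
    by (rule monoidI) (auto simp: mat_cstar_def matrix_mul_assoc)
  have ring: "ring ?M"
    by (rule ringI[OF grp mon]) (auto simp: mat_cstar_def matrix_add_ldistrib matrix_add_rdistrib)
  have mod: "Module.module (ring_of_type_algebra :: complex ring) ?M"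
    by (rule moduleI[OF cring_from_type_algebra grp])
      (auto simp: mat_cstar_def ring_of_type_algebra_def vec_eq_iff distrib_left distrib_right mult.assoc
        intro!: arg_cong[of _ _ mat_code])
  let ?code = "mat_code :: complex^'n^'n \<Rightarrow> _"
  have ex: "\<exists>P. x = ?code P" if "x \<in> carrier ?M" for x
    using that by (auto simp: mat_cstar_def)
  have code: "?code P \<in> carrier ?M" for P
    by (simp add: mat_cstar_def)
  have ops: "?code P \<otimes>\<^bsub>?M\<^esub> ?code Q = ?code (P ** Q)" "?code P \<oplus>\<^bsub>?M\<^esub> ?code Q = ?code (P + Q)"
    "c \<odot>\<^bsub>?M\<^esub> ?code P = ?code (\<chi> i j. c * P $ i $ j)" "adj ?M (?code P) = ?code (mat_adj P)"
    "cnorm ?M (?code P) = mat_norm P" "\<zero>\<^bsub>?M\<^esub> = ?code 0" for P Q c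
    by (simp_all add: mat_cstar_def)
  have inj: "?code P = ?code Q \<longleftrightarrow> P = Q" for P Q
    by (metis mat_decode_code)
  show ?thesis
  proof (intro cstar_algebra.intro ring mod cstar_algebra_axioms.intro; ((drule ex)+)?; (elim exE)?; (simp only: ops inj code)?)
    have dist: "cdist ?M (?code P) (?code Q) = mat_norm (P - Q)" for P Q
    proof -
      have "?code P \<ominus>\<^bsub>?M\<^esub> ?code Q = ?code (P - Q)"
        using abelian_group.minus_eq[OF grp] abelian_group.minus_equality[OF grp, of "?code (- Q)" "?code Q"]
        by (simp add: mat_cstar_def)
      then show ?thesis
        by (simp add: cdist_def) (simp add: mat_cstar_def)
    qed
    \<comment> \<open>\<open>Metric_space_cdist\<close> presupposes the locale being established, so
      the metric axioms are checked directly.\<close>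
    have "cdist ?M x z \<le> cdist ?M x y + cdist ?M y z"
      if "x \<in> carrier ?M" "y \<in> carrier ?M" "z \<in> carrier ?M" for x y z
    proof -
      obtain P Q R where "x = ?code P" "y = ?code Q" "z = ?code R"
        using \<open>x \<in> _\<close> \<open>y \<in> _\<close> \<open>z \<in> _\<close> by (auto simp: mat_cstar_def)
      then show ?thesis
        using mat_norm_add[of "P - Q" "Q - R"] by (simp add: dist)
    qed
    moreover have "cdist ?M x y = cdist ?M y x" for x y
    proof (cases "x \<in> carrier ?M \<and> y \<in> carrier ?M")
      case True
      then obtain P Q where "x = ?code P" "y = ?code Q"
        by (auto simp: mat_cstar_def)
      moreover have "mat_norm (P - Q) = mat_norm (Q - P)"
        using mat_norm_smult[of "-1" "P - Q"] by (simp add: minus_vec_def)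
      ultimately show ?thesis by (simp add: dist)
    qed (auto simp: cdist_def)
    moreover have "cdist ?M x y = 0 \<longleftrightarrow> x = y"
      if "x \<in> carrier ?M" "y \<in> carrier ?M" for x y
    proof -
      obtain P Q where "x = ?code P" "y = ?code Q"
        using \<open>x \<in> _\<close> \<open>y \<in> _\<close> by (auto simp: mat_cstar_def)
      then show ?thesis
        by (simp add: dist mat_norm_eq_0) (metis mat_decode_code)
    qed
    moreover have "0 \<le> cdist ?M x y" for x y
      by (auto simp: cdist_def) (auto simp: mat_cstar_def mat_norm_nonneg)
    ultimately interpret D: Metric_space "carrier ?M" "cdist ?M"
      by unfold_locales
    show D.mcomplete
      unfolding D.mcomplete_def
    proof (intro allI impI)
      fix \<sigma> assume \<sigma>: "D.MCauchy \<sigma>"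
      define f where "f n = (mat_decode (\<sigma> n) :: complex^'n^'n)" for n
      have \<sigma>_eq: "\<sigma> n = ?code (f n)" for n
      proof -
        have "\<sigma> n \<in> carrier ?M"
          using \<sigma> unfolding D.MCauchy_def by blast
        then show ?thesis
          using ex[of "\<sigma> n"] by (auto simp: f_def)
      qed
      let ?b = "real CARD('n) * real CARD('n)"
      have "Cauchy f"
      proof (rule metric_CauchyI)
        fix e :: real assume "e > 0"
        then have "e / ?b > 0" by simp
        then obtain N where N: "mat_norm (f m - f n) < e / ?b" if "m \<ge> N" "n \<ge> N" for m n
          using \<sigma> unfolding D.MCauchy_def \<sigma>_eq dist by blast
        have "dist (f m) (f n) < e" if "m \<ge> N" "n \<ge> N" for m n
        proof -
          have "dist (f m) (f n) \<le> ?b * mat_norm (f m - f n)"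
            by (simp add: dist_norm norm_le_mat_norm)
          also have "\<dots> < e"
            using N[OF that] by (simp add: field_simps)
          finally show ?thesis .
        qed
        then show "\<exists>N. \<forall>m\<ge>N. \<forall>n\<ge>N. dist (f m) (f n) < e" by blast
      qed
      then obtain L where L: "f \<longlonglongrightarrow> L"
        using Cauchy_convergent convergent_def by blast
      have "limitin D.mtopology \<sigma> (?code L) sequentially"
        unfolding D.limit_metric_sequentially
      proof (intro conjI allI impI code)
        fix e :: real assume "e > 0"
        then obtain N where N: "norm (f n - L) < e" if "n \<ge> N" for n
          using LIMSEQ_D[OF L] by blast
        have "\<sigma> n \<in> carrier ?M \<and> cdist ?M (\<sigma> n) (?code L) < e" if "n \<ge> N" for n
          unfolding \<sigma>_eq dist using code[of "f n"] le_less_trans[OF mat_norm_le_norm N[OF that]] by simp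
        then show "\<exists>N. \<forall>n\<ge>N. \<sigma> n \<in> carrier ?M \<and> cdist ?M (\<sigma> n) (?code L) < e" by blast
      qed
      then show "\<exists>x. limitin D.mtopology \<sigma> x sequentially"
        by (rule exI[where x = "?code L"])
    qed
  qed (rule mat_norm_nonneg mat_norm_eq_0 mat_norm_add mat_norm_smult mat_norm_mult mat_norm_cstar
      mat_adj_adj mat_adj_mult mat_adj_add mat_adj_smult
      matrix_smult_mult_left matrix_smult_mult_right)+
qed


section \<open>The family of representations\<close>

text \<open>For a unit vector (c, s) this is the orthogonal projection onto the line through
  it.\<close>

definition rank_one :: "real \<Rightarrow> real \<Rightarrow> complex^2^2" where
  "rank_one c s = (\<chi> i j. complex_of_real ((if i = 1 then c else s) * (if j = 1 then c else s)))"

text \<open>Two diagonal blocks, each with a projection P on its diagonal and 1 - P off it, where P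
  projects onto the line at angle t in the first block and -t in the second. At t = 0 both P are
  diag(1, 0), so the model is the direct sum of the identity permutation and the swap (1 2)(3 4). A
  pair of projections amounts to a representation of the infinite dihedral group, hence the
  name.\<close>

definition dihedral_model :: "real \<Rightarrow> nat \<Rightarrow> nat \<Rightarrow> complex^2^2" where
  "dihedral_model t i j =
     (if i \<in> {1, 2} \<and> j \<in> {1, 2} then
        (if i = j then rank_one (cos t) (sin t) else rank_one (- sin t) (cos t))
      else if i \<in> {3, 4} \<and> j \<in> {3, 4} then
        (if i = j then rank_one (cos t) (- sin t) else rank_one (sin t) (cos t))
      else 0)"

lemma mat_adj_rank_one [simp]: "mat_adj (rank_one c s) = rank_one c s"
  by (simp add: mat_adj_def rank_one_def vec_eq_iff)

lemma rank_one_mult: "rank_one c s ** rank_one c' s' =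
    (\<chi> i j. complex_of_real ((if i = 1 then c else s) * (c * c' + s * s') * (if j = 1 then c' else s')))"
  by (simp add: rank_one_def matrix_matrix_mult_def vec_eq_iff sum_2 algebra_simps)

lemma rank_one_idem: "c\<^sup>2 + s\<^sup>2 = 1 \<Longrightarrow> rank_one c s ** rank_one c s = rank_one c s"
  by (simp add: rank_one_mult flip: power2_eq_square) (simp add: rank_one_def)

lemma rank_one_orth: "c * c' + s * s' = 0 \<Longrightarrow> rank_one c s ** rank_one c' s' = 0"
  by (simp add: rank_one_mult vec_eq_iff)

lemma rank_one_add: "c\<^sup>2 + s\<^sup>2 = 1 \<Longrightarrow> rank_one c s + rank_one (- s) c = mat 1"
  by (simp add: rank_one_def vec_eq_iff forall_2 mat_def power2_eq_square add.commute
      flip: of_real_mult of_real_add)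

lemma mat_adj_0 [simp]: "mat_adj 0 = 0"
  by (simp add: mat_adj_def vec_eq_iff)

lemma atLeastAtMost_1_4: "{1..4::nat} = {1, 2, 3, 4}"
  by auto

lemma (in abelian_monoid) finsum_1_4:
  assumes "f 1 \<in> carrier G" "f 2 \<in> carrier G" "f 3 \<in> carrier G" "f 4 \<in> carrier G"
  shows "(\<Oplus>i\<in>{1..4::nat}. f i) = f 1 \<oplus> (f 2 \<oplus> (f 3 \<oplus> f 4))"
  unfolding atLeastAtMost_1_4 using assms by (simp del: One_nat_def)

lemma magic_unitary_dihedral_model: "magic_unitary 4 (mat_cstar TYPE(2)) (\<lambda>i j. mat_code (dihedral_model t i j))"
proof -
  interpret cstar_algebra "mat_cstar TYPE(2)"
    by (rule cstar_algebra_mat)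
  let ?M = "mat_cstar TYPE(2)"
  let ?code = "mat_code :: complex^2^2 \<Rightarrow> _"
  have code: "?code P \<in> carrier ?M" for P
    by (simp add: mat_cstar_def)
  have ops: "?code P \<otimes>\<^bsub>?M\<^esub> ?code Q = ?code (P ** Q)" "?code P \<oplus>\<^bsub>?M\<^esub> ?code Q = ?code (P + Q)"
    "adj ?M (?code P) = ?code (mat_adj P)" "\<zero>\<^bsub>?M\<^esub> = ?code 0" "\<one>\<^bsub>?M\<^esub> = ?code (mat 1)" for P Q
    by (simp_all add: mat_cstar_def)
  have idem: "rank_one (cos t) (sin t) ** rank_one (cos t) (sin t) = rank_one (cos t) (sin t)"
    "rank_one (- sin t) (cos t) ** rank_one (- sin t) (cos t) = rank_one (- sin t) (cos t)"
    "rank_one (cos t) (- sin t) ** rank_one (cos t) (- sin t) = rank_one (cos t) (- sin t)"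
    "rank_one (sin t) (cos t) ** rank_one (sin t) (cos t) = rank_one (sin t) (cos t)"
    by (rule rank_one_idem; simp)+
  have orth: "rank_one (cos t) (sin t) ** rank_one (- sin t) (cos t) = 0"
    "rank_one (- sin t) (cos t) ** rank_one (cos t) (sin t) = 0"
    "rank_one (cos t) (- sin t) ** rank_one (sin t) (cos t) = 0"
    "rank_one (sin t) (cos t) ** rank_one (cos t) (- sin t) = 0"
    by (rule rank_one_orth; simp)+
  have add: "rank_one (cos t) (sin t) + rank_one (- sin t) (cos t) = mat 1"
    "rank_one (cos t) (- sin t) + rank_one (sin t) (cos t) = mat 1"
    using rank_one_add[of "cos t" "sin t"] rank_one_add[of "cos t" "- sin t"] by simp_all
  then have add': "rank_one (- sin t) (cos t) + rank_one (cos t) (sin t) = mat 1"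
    "rank_one (sin t) (cos t) + rank_one (cos t) (- sin t) = mat 1"
    by (simp_all only: add.commute)
  have sum: "(\<Oplus>\<^bsub>?M\<^esub>j\<in>{1..4}. ?code (P j)) = ?code (P 1 + (P 2 + (P 3 + P 4)))"
    for P :: "nat \<Rightarrow> complex^2^2"
    using A.finsum_1_4[of "\<lambda>j. ?code (P j)"] by (simp only: code ops)
  show ?thesis
    unfolding magic_unitary_def sum projection_def ops
    by (auto simp: atLeastAtMost_1_4 dihedral_model_def code idem orth add add')
qed


section \<open>First-order invariance\<close>

context cstar_algebra
begin

lemma csmult_closed [simp]: "x \<in> carrier A \<Longrightarrow> c \<odot>\<^bsub>A\<^esub> x \<in> carrier A"
  using V.smult_closed[of c x] by (simp add: ring_of_type_algebra_def)

lemma csmult_add_left: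
  "x \<in> carrier A \<Longrightarrow> (c + d) \<odot>\<^bsub>A\<^esub> x = c \<odot>\<^bsub>A\<^esub> x \<oplus>\<^bsub>A\<^esub> d \<odot>\<^bsub>A\<^esub> x"
  using V.smult_l_distr[of c d x] by (simp add: ring_of_type_algebra_def)

lemma csmult_add_right:
  "\<lbrakk>x \<in> carrier A; y \<in> carrier A\<rbrakk> \<Longrightarrow> c \<odot>\<^bsub>A\<^esub> (x \<oplus>\<^bsub>A\<^esub> y) = c \<odot>\<^bsub>A\<^esub> x \<oplus>\<^bsub>A\<^esub> c \<odot>\<^bsub>A\<^esub> y"
  using V.smult_r_distr[of c x y] by (simp add: ring_of_type_algebra_def)

lemma csmult_assoc: "x \<in> carrier A \<Longrightarrow> (c * d) \<odot>\<^bsub>A\<^esub> x = c \<odot>\<^bsub>A\<^esub> (d \<odot>\<^bsub>A\<^esub> x)"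
  using V.smult_assoc1[of c d x] by (simp add: ring_of_type_algebra_def)

lemma csmult_one [simp]: "x \<in> carrier A \<Longrightarrow> 1 \<odot>\<^bsub>A\<^esub> x = x"
  using V.smult_one[of x] by (simp add: ring_of_type_algebra_def)

lemma csmult_zero_left [simp]: "x \<in> carrier A \<Longrightarrow> 0 \<odot>\<^bsub>A\<^esub> x = \<zero>\<^bsub>A\<^esub>"
  using cnorm_eq_0[of "0 \<odot>\<^bsub>A\<^esub> x"] by (simp add: cnorm_smult)

lemma csmult_mult:
  assumes "x \<in> carrier A" "y \<in> carrier A"
  shows "(c \<odot>\<^bsub>A\<^esub> x) \<otimes>\<^bsub>A\<^esub> (d \<odot>\<^bsub>A\<^esub> y) = (c * d) \<odot>\<^bsub>A\<^esub> (x \<otimes>\<^bsub>A\<^esub> y)"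
  using assms by (simp add: smult_mult_left smult_mult_right mult.commute flip: csmult_assoc)

lemma csmult_pow:
  "x \<in> carrier A \<Longrightarrow> (c \<odot>\<^bsub>A\<^esub> x) [^]\<^bsub>A\<^esub> (k :: nat) = (c ^ k) \<odot>\<^bsub>A\<^esub> (x [^]\<^bsub>A\<^esub> k)"
  by (induction k) (simp_all add: csmult_mult mult.commute)

lemma csmult_minus_one: "x \<in> carrier A \<Longrightarrow> (- 1) \<odot>\<^bsub>A\<^esub> x = \<ominus>\<^bsub>A\<^esub> x"
  using csmult_add_left[of x "- 1" 1] by (intro A.minus_equality[symmetric]) simp_all

end

lemma clinear_mapD:
  assumes "clinear_map A B f"
  shows "x \<in> carrier A \<Longrightarrow> f x \<in> carrier B"
    and "\<lbrakk>x \<in> carrier A; y \<in> carrier A\<rbrakk> \<Longrightarrow> f (x \<oplus>\<^bsub>A\<^esub> y) = f x \<oplus>\<^bsub>B\<^esub> f y"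
    and "x \<in> carrier A \<Longrightarrow> f (c \<odot>\<^bsub>A\<^esub> x) = c \<odot>\<^bsub>B\<^esub> f x"
  using assms by (auto simp: clinear_map_def)

text \<open>\<open>F\<close> is the slice map h \<otimes> id, which turns invariance of
  \<open>h\<close> into \<open>invariant\<close>; \<open>\<pi>\<close> is a family of
  representations by 2 by 2 matrices, specified later through its values on the generators.\<close>

locale haar_setup =
  fixes A :: "'a cstar" (structure) and T :: "'t cstar" and ten :: "'a \<Rightarrow> 'a \<Rightarrow> 't"
    and \<Delta> :: "'a \<Rightarrow> 't" and h :: "'a \<Rightarrow> complex" and F :: "'t \<Rightarrow> 'a"
    and \<pi> :: "real \<Rightarrow> 'a \<Rightarrow> complex^2^2"
  assumes tensor: "tensor_completion A A T ten"
    and \<Delta>_hom: "star_hom A T \<Delta>"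
    and h_state: "state A h"
    and slice: "slice_left A A T ten h F"
    and invariant: "x \<in> carrier A \<Longrightarrow> F (\<Delta> x) = h x \<odot>\<^bsub>A\<^esub> \<one>\<^bsub>A\<^esub>"
    and \<pi>_mult: "\<lbrakk>x \<in> carrier A; y \<in> carrier A\<rbrakk> \<Longrightarrow> \<pi> t (x \<otimes> y) = \<pi> t x ** \<pi> t y"
    and \<pi>_add: "\<lbrakk>x \<in> carrier A; y \<in> carrier A\<rbrakk> \<Longrightarrow> \<pi> t (x \<oplus> y) = \<pi> t x + \<pi> t y"
    and \<pi>_one: "\<pi> t \<one> = mat 1"
    and \<pi>_smult: "x \<in> carrier A \<Longrightarrow> \<pi> t (c \<odot> x) = (\<chi> i j. c * \<pi> t x $ i $ j)"

sublocale haar_setup \<subseteq> cstar_algebra A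
  using tensor by (simp add: tensor_completion_def)

sublocale haar_setup \<subseteq> T: cstar_algebra T
  using tensor by (simp add: tensor_completion_def)

section \<open>First-order expansions along a family of representations\<close>

context haar_setup
begin

lemma ten_closed [simp]: "\<lbrakk>x \<in> carrier A; y \<in> carrier A\<rbrakk> \<Longrightarrow> ten x y \<in> carrier T"
  using tensor by (auto simp: tensor_completion_def clinear_map_def)

lemma ten_mult: "\<lbrakk>x \<in> carrier A; y \<in> carrier A; x' \<in> carrier A; y' \<in> carrier A\<rbrakk> \<Longrightarrow>
    ten x y \<otimes>\<^bsub>T\<^esub> ten x' y' = ten (x \<otimes> x') (y \<otimes> y')"
  using tensor by (simp add: tensor_completion_def)

lemma ten_smult: "\<lbrakk>x \<in> carrier A; y \<in> carrier A\<rbrakk> \<Longrightarrow> c \<odot>\<^bsub>T\<^esub> ten x y = ten (c \<odot> x) y"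
  using tensor clinear_mapD(3)[of A T "\<lambda>a. ten a y" x] by (simp add: tensor_completion_def)

lemma ten_one: "ten \<one> \<one> = \<one>\<^bsub>T\<^esub>"
  using tensor by (simp add: tensor_completion_def)

lemma h_add: "\<lbrakk>x \<in> carrier A; y \<in> carrier A\<rbrakk> \<Longrightarrow> h (x \<oplus> y) = h x + h y"
  and h_smult: "x \<in> carrier A \<Longrightarrow> h (c \<odot> x) = c * h x"
  and h_one: "h \<one> = 1"
  using h_state by (auto simp: state_def)

lemma h_minus: "\<lbrakk>x \<in> carrier A; y \<in> carrier A\<rbrakk> \<Longrightarrow> h (x \<ominus> y) = h x - h y"
  using h_smult[of y "- 1"] by (simp add: A.minus_eq h_add csmult_minus_one)

lemma F_closed [simp]: "x \<in> carrier T \<Longrightarrow> F x \<in> carrier A"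
  and F_add: "\<lbrakk>x \<in> carrier T; y \<in> carrier T\<rbrakk> \<Longrightarrow> F (x \<oplus>\<^bsub>T\<^esub> y) = F x \<oplus> F y"
  and F_ten: "\<lbrakk>a \<in> carrier A; b \<in> carrier A\<rbrakk> \<Longrightarrow> F (ten a b) = h a \<odot> b"
  using slice by (auto simp: slice_left_def dest: clinear_mapD)

text \<open>Diagonality at 0 makes the product rule close up: the upper right entry of the
  derivative of P Q is then \<open>P11 * Q12' + P12' * Q22\<close>, with no other entries
  involved.\<close>

definition mat_deriv :: "'a \<Rightarrow> complex^2^2 \<Rightarrow> bool" where
  "mat_deriv z D \<longleftrightarrow> z \<in> carrier A \<and> \<pi> 0 z $ 1 $ 2 = 0 \<and> \<pi> 0 z $ 2 $ 1 = 0 \<and>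
     (\<forall>i j. ((\<lambda>t. \<pi> t z $ i $ j) has_vector_derivative D $ i $ j) (at 0))"

lemma mat_deriv_mult:
  assumes "mat_deriv z D" "mat_deriv z' D'"
  shows "mat_deriv (z \<otimes> z') (\<pi> 0 z ** D' + D ** \<pi> 0 z')"
proof -
  have "((\<lambda>t. \<Sum>k\<in>UNIV. \<pi> t z $ i $ k * \<pi> t z' $ k $ j) has_vector_derivative
      (\<Sum>k\<in>UNIV. \<pi> 0 z $ i $ k * D' $ k $ j + D $ i $ k * \<pi> 0 z' $ k $ j)) (at 0)" for i j
    using assms unfolding mat_deriv_def
    by (intro has_vector_derivative_sum has_vector_derivative_mult) auto
  then show ?thesis
    using assms by (auto simp: mat_deriv_def \<pi>_mult matrix_matrix_mult_def sum_2 algebra_simps)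
qed

text \<open>\<open>jet \<Theta> a b c\<close> records the first-order expansion at \<open>t = 0\<close> of the matrix
  \<open>(id \<otimes> \<pi> t) \<Theta>\<close> over \<open>A\<close>: its value is \<open>diag(a, b)\<close> and \<open>c\<close> is the upper right entry of its
  derivative. An inductive predicate is used because \<open>id \<otimes> \<pi> t\<close> is only needed on algebraic
  tensors, where neither its existence nor its continuity has to be discussed.\<close>

inductive jet :: "'t \<Rightarrow> 'a \<Rightarrow> 'a \<Rightarrow> 'a \<Rightarrow> bool" where
  ten: "\<lbrakk>y \<in> carrier A; mat_deriv z D\<rbrakk> \<Longrightarrow>
      jet (ten y z) (\<pi> 0 z $ 1 $ 1 \<odot> y) (\<pi> 0 z $ 2 $ 2 \<odot> y) (D $ 1 $ 2 \<odot> y)"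
| add: "\<lbrakk>jet \<Theta> a b c; jet \<Theta>' a' b' c'\<rbrakk> \<Longrightarrow> jet (\<Theta> \<oplus>\<^bsub>T\<^esub> \<Theta>') (a \<oplus> a') (b \<oplus> b') (c \<oplus> c')"

lemma jet_closed:
  assumes "jet \<Theta> a b c"
  shows "\<Theta> \<in> carrier T" "a \<in> carrier A" "b \<in> carrier A" "c \<in> carrier A"
  using assms by (induction; simp add: mat_deriv_def)+

text \<open>On an elementary tensor \<open>F\<close> leaves h y times z, so
  \<open>\<pi> t (F \<Theta>)\<close> is (h \<otimes> \<pi> t) \<Theta>, and its expansion is the
  jet of \<Theta> with \<open>h\<close> applied to each component.\<close>

lemma jet_slice:
  assumes "jet \<Theta> a b c"
  shows "\<pi> 0 (F \<Theta>) $ 1 $ 1 = h a \<and> \<pi> 0 (F \<Theta>) $ 2 $ 2 = h b \<and>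
    ((\<lambda>t. \<pi> t (F \<Theta>) $ 1 $ 2) has_vector_derivative h c) (at 0)"
  using assms
proof induction
  case (ten y z D)
  then have z: "z \<in> carrier A" "((\<lambda>t. \<pi> t z $ 1 $ 2) has_vector_derivative D $ 1 $ 2) (at 0)"
    by (auto simp: mat_deriv_def)
  have "((\<lambda>t. h y * \<pi> t z $ 1 $ 2) has_vector_derivative h y * D $ 1 $ 2) (at 0)"
    using z(2) by (rule has_vector_derivative_mult_right)
  then show ?case
    using ten z by (simp add: F_ten \<pi>_smult h_smult mult.commute)
next
  case (add \<Theta> a b c \<Theta>' a' b' c')
  then show ?case
    using jet_closed[OF add(1)] jet_closed[OF add(2)]
    by (auto simp: F_add \<pi>_add h_add intro: has_vector_derivative_add)
qed

lemma jet_smult: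
  assumes "jet \<Theta> a b c"
  shows "jet (d \<odot>\<^bsub>T\<^esub> \<Theta>) (d \<odot> a) (d \<odot> b) (d \<odot> c)"
  using assms
proof induction
  case (ten y z D)
  then have "z \<in> carrier A" by (simp add: mat_deriv_def)
  with jet.ten[of "d \<odot> y" z D] ten show ?case
    by (simp add: ten_smult mult.commute flip: csmult_assoc)
next
  case (add \<Theta> a b c \<Theta>' a' b' c')
  from jet.add[OF add.IH] show ?case
    using jet_closed[OF add.hyps(1)] jet_closed[OF add.hyps(2)]
    by (simp add: csmult_add_right T.csmult_add_right)
qed

text \<open>The product rule needs an induction on each factor; this one runs over the right factor
  while the left one stays elementary.\<close>

lemma jet_ten_mult:
  assumes "jet \<Theta> a b c" and y: "y \<in> carrier A" and z: "mat_deriv z D"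
  shows "jet (ten y z \<otimes>\<^bsub>T\<^esub> \<Theta>) ((\<pi> 0 z $ 1 $ 1 \<odot> y) \<otimes> a) ((\<pi> 0 z $ 2 $ 2 \<odot> y) \<otimes> b)
     ((\<pi> 0 z $ 1 $ 1 \<odot> y) \<otimes> c \<oplus> (D $ 1 $ 2 \<odot> y) \<otimes> b)"
  using assms(1)
proof induction
  case (ten y' z' D')
  have closed: "z \<in> carrier A" "z' \<in> carrier A"
    using z ten by (simp_all add: mat_deriv_def)
  show ?case
    using jet.ten[OF A.m_closed[OF y ten(1)] mat_deriv_mult[OF z ten(2)]] z ten y closed
    by (simp add: mat_deriv_def ten_mult \<pi>_mult matrix_matrix_mult_def sum_2 csmult_mult
        csmult_add_left)
next
  case (add \<Theta> a b c \<Theta>' a' b' c')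
  have "z \<in> carrier A"
    using z by (simp add: mat_deriv_def)
  with jet.add[OF add.IH] show ?case
    using jet_closed[OF add.hyps(1)] jet_closed[OF add.hyps(2)] y
    by (simp add: A.r_distr T.A.r_distr A.a_ac)
qed

text \<open>The triples multiply like upper triangular 2 by 2 matrices with diagonal a, b and corner
  c.\<close>

lemma jet_mult:
  assumes "jet \<Theta> a b c" and \<Theta>': "jet \<Theta>' a' b' c'"
  shows "jet (\<Theta> \<otimes>\<^bsub>T\<^esub> \<Theta>') (a \<otimes> a') (b \<otimes> b') (a \<otimes> c' \<oplus> c \<otimes> b')"
  using assms(1)
proof induction
  case (ten y z D)
  then show ?case
    by (rule jet_ten_mult[OF \<Theta>'])
next
  case (add \<Theta>1 a1 b1 c1 \<Theta>2 a2 b2 c2)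
  from jet.add[OF add.IH] show ?case
    using jet_closed[OF add.hyps(1)] jet_closed[OF add.hyps(2)] jet_closed[OF \<Theta>']
    by (simp add: A.l_distr T.A.l_distr A.a_ac)
qed

text \<open>For \<open>x\<close> in the algebra generated by the entries of \<open>u\<close>, \<open>b\<close> arises from \<open>x\<close> by swapping the
  columns \<open>1 \<leftrightarrow> 2\<close> and \<open>3 \<leftrightarrow> 4\<close>, and \<open>x \<mapsto> c\<close> is a derivation twisted by that swap.\<close>

definition twisted_deriv :: "'a \<Rightarrow> 'a \<Rightarrow> 'a \<Rightarrow> bool" where
  "twisted_deriv x b c \<longleftrightarrow> x \<in> carrier A \<and> jet (\<Delta> x) x b c"

lemma \<Delta>_add: "\<lbrakk>x \<in> carrier A; y \<in> carrier A\<rbrakk> \<Longrightarrow> \<Delta> (x \<oplus> y) = \<Delta> x \<oplus>\<^bsub>T\<^esub> \<Delta> y"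
  and \<Delta>_mult: "\<lbrakk>x \<in> carrier A; y \<in> carrier A\<rbrakk> \<Longrightarrow> \<Delta> (x \<otimes> y) = \<Delta> x \<otimes>\<^bsub>T\<^esub> \<Delta> y"
  and \<Delta>_one: "\<Delta> \<one> = \<one>\<^bsub>T\<^esub>"
  and \<Delta>_smult: "x \<in> carrier A \<Longrightarrow> \<Delta> (d \<odot> x) = d \<odot>\<^bsub>T\<^esub> \<Delta> x"
  using \<Delta>_hom by (auto simp: star_hom_def ring_hom_def clinear_map_def)

lemma twisted_deriv_closed:
  assumes "twisted_deriv x b c"
  shows "x \<in> carrier A" "b \<in> carrier A" "c \<in> carrier A"
  using assms jet_closed by (auto simp: twisted_deriv_def)

lemma twisted_deriv_add:
  "\<lbrakk>twisted_deriv x b c; twisted_deriv x' b' c'\<rbrakk> \<Longrightarrow>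
     twisted_deriv (x \<oplus> x') (b \<oplus> b') (c \<oplus> c')"
  by (simp add: twisted_deriv_def \<Delta>_add jet.add)

lemma twisted_deriv_mult:
  "\<lbrakk>twisted_deriv x b c; twisted_deriv x' b' c'\<rbrakk> \<Longrightarrow>
     twisted_deriv (x \<otimes> x') (b \<otimes> b') (x \<otimes> c' \<oplus> c \<otimes> b')"
  by (simp add: twisted_deriv_def \<Delta>_mult jet_mult)

lemma twisted_deriv_minus:
  assumes "twisted_deriv x b c" "twisted_deriv x' b' c'"
  shows "twisted_deriv (x \<ominus> x') (b \<ominus> b') (c \<ominus> c')"
proof -
  have "twisted_deriv ((- 1) \<odot> x') ((- 1) \<odot> b') ((- 1) \<odot> c')"
    using assms(2) by (simp add: twisted_deriv_def \<Delta>_smult jet_smult)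
  from twisted_deriv_add[OF assms(1) this] show ?thesis
    using twisted_deriv_closed[OF assms(2)] by (simp add: csmult_minus_one A.minus_eq)
qed

lemma twisted_deriv_one: "twisted_deriv \<one> \<one> \<zero>"
proof -
  have "mat_deriv \<one> 0"
    by (simp add: mat_deriv_def \<pi>_one mat_def)
  from jet.ten[OF A.one_closed this] show ?thesis
    by (simp add: twisted_deriv_def \<Delta>_one ten_one \<pi>_one mat_def)
qed

text \<open>\<open>F (\<Delta> x)\<close> is h x times the unit, so \<open>\<pi> t\<close> maps it
  to a scalar matrix independent of t. Comparing with \<open>jet_slice\<close>, the lower right
  entry gives the first claim and the derivative of the upper right entry the second.\<close>

lemma haar_twisted_deriv:
  assumes "twisted_deriv x b c"
  shows "h b = h x" "h c = 0"
proof -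
  have x: "x \<in> carrier A" and jet: "jet (\<Delta> x) x b c"
    using assms by (simp_all add: twisted_deriv_def)
  have \<pi>: "\<pi> t (F (\<Delta> x)) $ i $ j = (if i = j then h x else 0)" for t i j
    by (simp add: invariant x \<pi>_smult \<pi>_one mat_def)
  from jet_slice[OF jet] show "h b = h x" "h c = 0"
    unfolding \<pi> by (auto dest: vector_derivative_unique_at[OF has_vector_derivative_const])
qed

end

section \<open>Two orthogonal splittings of one element\<close>

context ring
begin

text \<open>The intended summands are a = u11 + u22, c = u12 + u21, b = u33 + u44 and d = u34 + u43.
  These are sums of projections and in general not idempotent, so everything is drawn from
  orthogonality and the common sum Z. In the notation of the overview, D = a + b, \<tau> D = c + d
  and E = a - b.\<close>

lemma split_projections:
  assumes closed: "a \<in> carrier R" "b \<in> carrier R" "c \<in> carrier R" "d \<in> carrier R"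
    and orth: "a \<otimes> c = \<zero>" "c \<otimes> a = \<zero>" "b \<otimes> d = \<zero>" "d \<otimes> b = \<zero>"
    and eq: "a \<oplus> c = b \<oplus> d"
  shows "(a \<oplus> c) \<otimes> a = a \<otimes> a" "(a \<oplus> c) \<otimes> (c \<oplus> d) = (c \<oplus> d) \<otimes> (a \<oplus> c)"
    "(a \<oplus> b) \<oplus> (c \<oplus> d) = (a \<oplus> c) \<oplus> (a \<oplus> c)"
    "(a \<ominus> b) \<otimes> (a \<ominus> b) = (a \<oplus> b) \<otimes> (c \<oplus> d)"
    "(a \<oplus> b) \<otimes> (c \<oplus> d) = (c \<oplus> d) \<otimes> (a \<oplus> b)"
    "(a \<ominus> b) \<otimes> (a \<oplus> b) = (c \<oplus> d) \<otimes> (a \<ominus> b)"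
    "(a \<ominus> c) \<oplus> (d \<ominus> b) = (a \<ominus> b) \<oplus> (a \<ominus> b)"
    "(a \<ominus> c) \<ominus> (d \<ominus> b) = (a \<oplus> b) \<ominus> (c \<oplus> d)"
proof -
  show "(a \<oplus> c) \<otimes> a = a \<otimes> a"
    using closed orth by (simp add: l_distr)
  \<comment> \<open>Multiply the common sum by a and by b on either side and drop the orthogonal
    products.\<close>
  have prods: "a \<otimes> a = b \<otimes> a \<oplus> d \<otimes> a" "a \<otimes> a = a \<otimes> b \<oplus> a \<otimes> d"
    "b \<otimes> b = a \<otimes> b \<oplus> c \<otimes> b" "b \<otimes> b = b \<otimes> a \<oplus> b \<otimes> c"
  proof -
    have "(a \<oplus> c) \<otimes> a = (b \<oplus> d) \<otimes> a" "a \<otimes> (a \<oplus> c) = a \<otimes> (b \<oplus> d)"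
      "(a \<oplus> c) \<otimes> b = (b \<oplus> d) \<otimes> b" "b \<otimes> (a \<oplus> c) = b \<otimes> (b \<oplus> d)"
      using eq by simp_all
    then show "a \<otimes> a = b \<otimes> a \<oplus> d \<otimes> a" "a \<otimes> a = a \<otimes> b \<oplus> a \<otimes> d"
      "b \<otimes> b = a \<otimes> b \<oplus> c \<otimes> b" "b \<otimes> b = b \<otimes> a \<oplus> b \<otimes> c"
      using closed orth by (simp_all add: l_distr r_distr)
  qed
  show "(a \<oplus> c) \<otimes> (c \<oplus> d) = (c \<oplus> d) \<otimes> (a \<oplus> c)"
  proof -
    \<comment> \<open>The sum commutes with its own summands: with c through the first splitting,
      with d through the second.\<close>
    have "(a \<oplus> c) \<otimes> c = c \<otimes> (a \<oplus> c)"
      using closed orth by (simp add: l_distr r_distr)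
    moreover have "(a \<oplus> c) \<otimes> d = d \<otimes> (a \<oplus> c)"
      unfolding eq using closed orth by (simp add: l_distr r_distr)
    ultimately show ?thesis
      using closed by (simp only: r_distr[of c d "a \<oplus> c"] l_distr[of c d "a \<oplus> c"] add.m_closed)
  qed
  show "(a \<oplus> b) \<oplus> (c \<oplus> d) = (a \<oplus> c) \<oplus> (a \<oplus> c)"
  proof -
    have "(a \<oplus> b) \<oplus> (c \<oplus> d) = (a \<oplus> c) \<oplus> (b \<oplus> d)"
      using closed by (simp add: a_ac)
    then show ?thesis by (simp add: eq)
  qed
  have ee: "(a \<ominus> b) \<otimes> (a \<ominus> b) = a \<otimes> a \<ominus> a \<otimes> b \<oplus> (b \<otimes> b \<ominus> b \<otimes> a)"
    using closed by (simp add: ring_simprules)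
  have cancel: "(x \<oplus> y) \<ominus> x = y" if "x \<in> carrier R" "y \<in> carrier R" for x y
    using that by (simp add: a_comm[of x y] minus_eq a_assoc r_neg)
  show "(a \<ominus> b) \<otimes> (a \<ominus> b) = (a \<oplus> b) \<otimes> (c \<oplus> d)"
  proof -
    have "a \<otimes> a \<ominus> a \<otimes> b = a \<otimes> d" "b \<otimes> b \<ominus> b \<otimes> a = b \<otimes> c"
      unfolding prods(2,4) using closed by (simp_all add: cancel)
    then show ?thesis
      using closed orth by (simp add: ee l_distr r_distr a_ac)
  qed
  \<comment> \<open>Products across the two splittings are rewritten through those of a and b; the
    remaining identities then become linear.\<close>
  have da: "d \<otimes> a = a \<otimes> a \<ominus> b \<otimes> a" and cb: "c \<otimes> b = b \<otimes> b \<ominus> a \<otimes> b"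
    unfolding prods(1,3) using closed by (simp_all add: cancel)
  have ad: "a \<otimes> d = a \<otimes> a \<ominus> a \<otimes> b" and bc: "b \<otimes> c = b \<otimes> b \<ominus> b \<otimes> a"
    unfolding prods(2,4) using closed by (simp_all add: cancel)
  show "(a \<oplus> b) \<otimes> (c \<oplus> d) = (c \<oplus> d) \<otimes> (a \<oplus> b)"
    using closed by (simp add: l_distr r_distr orth da cb ad bc minus_eq a_ac)
  show "(a \<ominus> b) \<otimes> (a \<oplus> b) = (c \<oplus> d) \<otimes> (a \<ominus> b)"
    using closed by (simp add: minus_eq l_distr r_distr l_minus r_minus minus_add orth)
      (simp add: da cb minus_eq minus_add a_ac)
  have "d = (a \<oplus> c) \<ominus> b"
    unfolding eq using closed by (simp add: cancel)
  then have "d \<ominus> c = a \<oplus> ((c \<oplus> (\<ominus> b)) \<ominus> c)"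
    using closed by (simp add: minus_eq a_assoc)
  then have "d \<ominus> c = a \<ominus> b"
    using closed by (simp add: cancel) (simp add: minus_eq)
  moreover have "(a \<ominus> c) \<oplus> (d \<ominus> b) = (a \<ominus> b) \<oplus> (d \<ominus> c)"
    using closed by (simp add: minus_eq a_ac)
  ultimately show "(a \<ominus> c) \<oplus> (d \<ominus> b) = (a \<ominus> b) \<oplus> (a \<ominus> b)"
    by simp
  show "(a \<ominus> c) \<ominus> (d \<ominus> b) = (a \<oplus> b) \<ominus> (c \<oplus> d)"
    using closed by (simp add: ring_simprules)
qed

end

text \<open>The opposite signs in the derivatives of the pairs a, c and b, d are what makes the
  derivative of D equal to 2 E. The recursion is obtained from E D^k Z^n, the second claim from Z^n
  a, and the third from D + D' = 2 Z alone.\<close>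

lemma (in haar_setup) haar_moment_recursion:
  fixes a b c d :: 'a and k n :: nat
  defines "D \<equiv> a \<oplus> b" and "Z \<equiv> a \<oplus> c"
  assumes a: "twisted_deriv a c (a \<ominus> c)" and c: "twisted_deriv c a (c \<ominus> a)"
    and b: "twisted_deriv b d (d \<ominus> b)" and d: "twisted_deriv d b (b \<ominus> d)"
    and orth: "a \<otimes> c = \<zero>" "c \<otimes> a = \<zero>" "b \<otimes> d = \<zero>" "d \<otimes> b = \<zero>"
    and eq: "a \<oplus> c = b \<oplus> d"
  shows "(2 * of_nat k + 1) * h (D [^] k \<otimes> Z [^] Suc n) = (of_nat k + 1) * h (D [^] Suc k \<otimes> Z [^] n)"
    and "h (Z [^] n \<otimes> a) = h (Z [^] Suc n) / 2"
    and "h (D [^] k \<otimes> (c \<oplus> d)) = 2 * h (D [^] k \<otimes> Z) - h (D [^] Suc k)"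
proof -
  define D' where "D' = c \<oplus> d"
  define E where "E = a \<ominus> b"
  note cl = twisted_deriv_closed(1)[OF a] twisted_deriv_closed(1)[OF b]
    twisted_deriv_closed(1)[OF c] twisted_deriv_closed(1)[OF d]
  note rels = A.split_projections[OF cl orth eq, folded D_def D'_def E_def Z_def]
  have cl' [simp]: "D \<in> carrier A" "D' \<in> carrier A" "E \<in> carrier A" "Z \<in> carrier A"
    using cl by (simp_all add: D_def D'_def E_def Z_def)
  have D: "twisted_deriv D D' (E \<oplus> E)"
    using twisted_deriv_add[OF a b, folded D_def D'_def] rels(7) by simp
  have Z: "twisted_deriv Z Z \<zero>"
  proof -
    have "c \<oplus> a = Z" "(a \<ominus> c) \<oplus> (c \<ominus> a) = \<zero>"
      using cl by (simp_all add: Z_def A.ring_simprules)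
    then show ?thesis
      using twisted_deriv_add[OF a c] by (simp add: Z_def)
  qed
  have Z_pow: "twisted_deriv (Z [^] m) (Z [^] m) \<zero>" for m :: nat
  proof (induction m)
    case 0
    then show ?case using twisted_deriv_one by simp
  next
    case (Suc m)
    then show ?case using twisted_deriv_mult[OF Suc Z] by simp
  qed
  have commute_pow: "x \<otimes> y [^] m = z [^] m \<otimes> x"
    if "x \<in> carrier A" "y \<in> carrier A" "z \<in> carrier A" "x \<otimes> y = z \<otimes> x"
    for x y z and m :: nat
  proof (induction m)
    case (Suc m)
    have "x \<otimes> y [^] Suc m = (x \<otimes> y [^] m) \<otimes> y"
      using that by (simp add: A.m_assoc)
    also have "\<dots> = z [^] m \<otimes> (x \<otimes> y)"
      using that by (simp add: Suc A.m_assoc)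
    also have "\<dots> = z [^] Suc m \<otimes> x"
      using that by (simp add: A.m_assoc)
    finally show ?case .
  qed (use that in simp)
  have DD': "h (D \<otimes> y) + h (D' \<otimes> y) = 2 * h (Z \<otimes> y)" "h (y \<otimes> D) + h (y \<otimes> D') = 2 * h (y \<otimes> Z)"
    if "y \<in> carrier A" for y
  proof -
    have "(D \<oplus> D') \<otimes> y = (Z \<oplus> Z) \<otimes> y" "y \<otimes> (D \<oplus> D') = y \<otimes> (Z \<oplus> Z)"
      using rels(3) by simp_all
    then have "h (D \<otimes> y \<oplus> D' \<otimes> y) = h (Z \<otimes> y \<oplus> Z \<otimes> y)"
        "h (y \<otimes> D \<oplus> y \<otimes> D') = h (y \<otimes> Z \<oplus> y \<otimes> Z)"
      using that by (simp_all add: A.l_distr A.r_distr)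
    then show "h (D \<otimes> y) + h (D' \<otimes> y) = 2 * h (Z \<otimes> y)"
        "h (y \<otimes> D) + h (y \<otimes> D') = 2 * h (y \<otimes> Z)"
      using that by (simp_all add: h_add)
  qed
  show "h (D [^] k \<otimes> (c \<oplus> d)) = 2 * h (D [^] k \<otimes> Z) - h (D [^] Suc k)"
    using DD'(2)[of "D [^] k"] by (simp add: D'_def algebra_simps)
  show "h (Z [^] n \<otimes> a) = h (Z [^] Suc n) / 2"
  proof -
    \<comment> \<open>The swap fixes Z and exchanges a and c.\<close>
    have "h (Z [^] n \<otimes> c) = h (Z [^] n \<otimes> a)"
      using haar_twisted_deriv(1)[OF twisted_deriv_mult[OF Z_pow a]] .
    moreover have "h (Z [^] Suc n) = h (Z [^] n \<otimes> a) + h (Z [^] n \<otimes> c)"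
      using cl cl'(4) by (simp add: h_add A.r_distr flip: Z_def) (simp add: Z_def h_add A.r_distr)
    ultimately show ?thesis by simp
  qed
  \<comment> \<open>The derivative e is the sum of the m words 2 D^i E D'^j with i + j = m - 1. Left
    multiplication by E turns each of them into 2 D D'^m, since E D = D' E and E^2 = D D'; only this
    product is recorded.\<close>
  have D_pow: "\<exists>e. twisted_deriv (D [^] m) (D' [^] m) e \<and>
      E \<otimes> e = (2 * of_nat m) \<odot> (D \<otimes> D' [^] m)" for m
  proof (induction m)
    case 0
    show ?case
      using twisted_deriv_one by (intro exI[of _ \<zero>]) simp
  next
    case (Suc m)
    then obtain e where e: "twisted_deriv (D [^] m) (D' [^] m) e"
      "E \<otimes> e = (2 * of_nat m) \<odot> (D \<otimes> D' [^] m)" by blast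
    have [simp]: "e \<in> carrier A"
      using twisted_deriv_closed[OF e(1)] by blast
    let ?x = "D \<otimes> D' [^] Suc m"
    have "E \<otimes> (D [^] m \<otimes> E) = D' [^] m \<otimes> (E \<otimes> E)"
      using commute_pow[of E D D' m] rels(6) by (simp flip: A.m_assoc)
    also have "\<dots> = (D' [^] m \<otimes> D) \<otimes> D'"
      using rels(4) by (simp add: A.m_assoc)
    also have "\<dots> = (D \<otimes> D' [^] m) \<otimes> D'"
      using commute_pow[of D D' D' m] rels(5) by simp
    also have "\<dots> = ?x"
      by (simp add: A.m_assoc)
    finally have "E \<otimes> (D [^] m \<otimes> (E \<oplus> E) \<oplus> e \<otimes> D') = ?x \<oplus> ?x \<oplus> (2 * of_nat m) \<odot> ?x"
      by (simp add: A.r_distr e(2) smult_mult_left A.m_assoc[symmetric])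
    also have "\<dots> = (2 * of_nat (Suc m)) \<odot> ?x"
      using csmult_add_left[of ?x 1 1] csmult_add_left[of ?x 2 "2 * of_nat m"] by simp
    finally show ?case
      using twisted_deriv_mult[OF e(1) D] by auto
  qed
  have D'_eq: "h (D' [^] m \<otimes> Z [^] l) = h (D [^] m \<otimes> Z [^] l)" for m l :: nat
    using D_pow[of m] haar_twisted_deriv(1) twisted_deriv_mult[OF _ Z_pow] by blast
  obtain e where e: "twisted_deriv (D [^] k) (D' [^] k) e" "E \<otimes> e = (2 * of_nat k) \<odot> (D \<otimes> D' [^] k)"
    using D_pow by blast
  have [simp]: "e \<in> carrier A"
    using twisted_deriv_closed[OF e(1)] by blast
  have E: "twisted_deriv E (c \<ominus> d) (D \<ominus> D')"
    using twisted_deriv_minus[OF a b, folded E_def] rels(8) by simp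
  let ?y = "D' [^] k \<otimes> Z [^] n"
  \<comment> \<open>This is h applied to the twisted derivative of E D^k Z^n: the term E e Z^n comes
    from D^k, the term (D - D') D'^k Z^n from E, and Z contributes nothing.\<close>
  have "h (E \<otimes> (e \<otimes> Z [^] n)) + (h (D \<otimes> ?y) - h (D' \<otimes> ?y)) = 0"
    using haar_twisted_deriv(2)[OF twisted_deriv_mult[OF E twisted_deriv_mult[OF e(1) Z_pow[of n]]]]
    by (simp add: h_add h_minus[symmetric]) (simp add: A.minus_eq A.l_distr A.l_minus)
  moreover have "h (E \<otimes> (e \<otimes> Z [^] n)) = 2 * of_nat k * h (D \<otimes> ?y)"
    by (simp add: e(2) smult_mult_left h_smult A.m_assoc flip: A.m_assoc[of E])
  moreover have "D' \<otimes> ?y = D' [^] Suc k \<otimes> Z [^] n"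
    using commute_pow[of D' D' D' k] by (simp flip: A.m_assoc)
  moreover have "Z \<otimes> ?y = D' [^] k \<otimes> Z [^] Suc n"
  proof -
    have "Z \<otimes> ?y = (D' [^] k \<otimes> Z) \<otimes> Z [^] n"
      using commute_pow[of Z D' D' k] rels(2) by (simp flip: A.m_assoc)
    then show ?thesis
      using commute_pow[of Z Z Z n] by (simp add: A.m_assoc)
  qed
  \<comment> \<open>Here x, y and w stand for h of D, D' and Z times \<open>?y\<close>; x is
    eliminated using x + y = 2 w.\<close>
  moreover have arith: "(2 * r + 1) * w = (r + 1) * y"
    if "2 * r * x + (x - y) = 0" "x + y = 2 * w" for r x y w :: complex
  proof -
    have "y = (2 * r + 1) * x" "w = (x + y) / 2"
      using that by (simp_all add: algebra_simps)
    then show ?thesis by (simp add: field_simps)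
  qed
  ultimately show "(2 * of_nat k + 1) * h (D [^] k \<otimes> Z [^] Suc n) = (of_nat k + 1) * h (D [^] Suc k \<otimes> Z [^] n)"
    using DD'(1)[of ?y] D'_eq[of k "Suc n"] D'_eq[of "Suc k" n]
    by (intro arith[of _ "h (D \<otimes> ?y)"]) (simp_all del: A.nat_pow_Suc)
qed


section \<open>Moments of the Haar functional\<close>

text \<open>The off-diagonal entry of the derivative of \<open>dihedral_model\<close> at t = 0; the
  diagonal entries have derivative 0 there.\<close>

definition dihedral_sign :: "nat \<Rightarrow> nat \<Rightarrow> complex" where
  "dihedral_sign i j =
     (if i \<in> {1, 2} \<and> j \<in> {1, 2} then (if i = j then 1 else - 1)
      else if i \<in> {3, 4} \<and> j \<in> {3, 4} then (if i = j then - 1 else 1) else 0)"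

lemma has_vector_derivative_rank_one:
  assumes f: "(f has_real_derivative f') (at t)" and g: "(g has_real_derivative g') (at t)"
  shows "((\<lambda>t. rank_one (f t) (g t) $ i $ j) has_vector_derivative
     complex_of_real ((if i = 1 then f' else g') * (if j = 1 then f t else g t) +
       (if i = 1 then f t else g t) * (if j = 1 then f' else g'))) (at t)"
  unfolding rank_one_def using f g
  by (auto intro!: has_vector_derivative_of_real derivative_eq_intros
      simp flip: has_real_derivative_iff_has_vector_derivative)

lemma has_vector_derivative_dihedral_model:
  "((\<lambda>t. dihedral_model t k l $ i $ j) has_vector_derivative (if i = j then 0 else dihedral_sign k l)) (at 0)"
proof -
  have 2: "i = 1 \<or> i = 2" "j = 1 \<or> j = 2"
    using exhaust_2 by blast+
  have sin: "(sin has_real_derivative 1) (at 0)" "((\<lambda>t. - sin t) has_real_derivative - 1) (at 0)"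
    and cos: "(cos has_real_derivative 0) (at 0)"
    by (auto intro!: derivative_eq_intros)
  show ?thesis
    using has_vector_derivative_rank_one[OF cos sin(1), of i j]
      has_vector_derivative_rank_one[OF sin(2) cos, of i j]
      has_vector_derivative_rank_one[OF cos sin(2), of i j]
      has_vector_derivative_rank_one[OF sin(1) cos, of i j] 2
    by (auto simp: dihedral_model_def dihedral_sign_def)
qed

section \<open>The calculus on the entries of the magic unitary\<close>

locale qperm4_model = haar_setup A T ten \<Delta> h F \<pi>
  for A :: "'a cstar" (structure) and T :: "'t cstar" and ten \<Delta> h F \<pi> +
  fixes u :: "nat \<Rightarrow> nat \<Rightarrow> 'a"
  assumes magic: "magic_unitary 4 A u"
    and \<Delta>_u: "\<lbrakk>i \<in> {1..4}; j \<in> {1..4}\<rbrakk> \<Longrightarrow> \<Delta> (u i j) = (\<Oplus>\<^bsub>T\<^esub>k\<in>{1..4}. ten (u i k) (u k j))"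
    and \<pi>_u: "\<lbrakk>i \<in> {1..4}; j \<in> {1..4}\<rbrakk> \<Longrightarrow> \<pi> t (u i j) = dihedral_model t i j"
begin

lemma u_closed: "\<lbrakk>i \<in> {1..4}; j \<in> {1..4}\<rbrakk> \<Longrightarrow> u i j \<in> carrier A"
  using magic by (simp add: magic_unitary_def projection_def)

lemma mat_deriv_u:
  assumes "i \<in> {1..4}" "j \<in> {1..4}"
  shows "mat_deriv (u i j) (\<chi> k l. if k = l then 0 else dihedral_sign i j)"
  using has_vector_derivative_dihedral_model assms
  by (auto simp: mat_deriv_def u_closed \<pi>_u dihedral_model_def rank_one_def)

text \<open>At t = 0 the upper left entry of the model is the counit, and the last hypothesis is the
  counit law for \<open>u i j\<close>. The lower right entry gives the swapped column.\<close>

lemma twisted_deriv_u_sum: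
  assumes i: "i \<in> {1..4}" and j: "j \<in> {1..4}"
    and "u i j = (\<Oplus>k\<in>{1..4}. dihedral_model 0 k j $ 1 $ 1 \<odot> u i k)"
  shows "twisted_deriv (u i j) (\<Oplus>k\<in>{1..4}. dihedral_model 0 k j $ 2 $ 2 \<odot> u i k)
    (\<Oplus>k\<in>{1..4}. dihedral_sign k j \<odot> u i k)"
proof -
  have mem: "(1::nat) \<in> {1..4}" "(2::nat) \<in> {1..4}" "(3::nat) \<in> {1..4}" "(4::nat) \<in> {1..4}"
    by simp_all
  have jet: "jet (ten (u i k) (u k j)) (dihedral_model 0 k j $ 1 $ 1 \<odot> u i k) (dihedral_model 0 k j $ 2 $ 2 \<odot> u i k)
      (dihedral_sign k j \<odot> u i k)" if "k \<in> {1..4}" for k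
    using jet.ten[OF u_closed[OF i that] mat_deriv_u[OF that j]] unfolding \<pi>_u[OF that j] by simp
  have "jet (\<Delta> (u i j)) (\<Oplus>k\<in>{1..4}. dihedral_model 0 k j $ 1 $ 1 \<odot> u i k)
      (\<Oplus>k\<in>{1..4}. dihedral_model 0 k j $ 2 $ 2 \<odot> u i k) (\<Oplus>k\<in>{1..4}. dihedral_sign k j \<odot> u i k)"
    unfolding \<Delta>_u[OF i j]
    by (subst A.finsum_1_4 T.A.finsum_1_4;
        (intro jet.add jet mem csmult_closed u_closed ten_closed i j)?)+
  then show ?thesis
    using assms(3) u_closed[OF i j] by (simp add: twisted_deriv_def)
qed

text \<open>Columns 3 and 4 have the opposite sign since the second block of the model turns by
  -t.\<close>

lemma twisted_deriv_u:
  assumes i: "i \<in> {1..4}"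
  shows "twisted_deriv (u i 1) (u i 2) (u i 1 \<ominus> u i 2)"
    "twisted_deriv (u i 2) (u i 1) (u i 2 \<ominus> u i 1)"
    "twisted_deriv (u i 3) (u i 4) (u i 4 \<ominus> u i 3)"
    "twisted_deriv (u i 4) (u i 3) (u i 3 \<ominus> u i 4)"
proof -
  have cl: "u i 1 \<in> carrier A" "u i 2 \<in> carrier A" "u i 3 \<in> carrier A" "u i 4 \<in> carrier A"
    using i by (simp_all add: u_closed)
  note simps = A.finsum_1_4 cl dihedral_model_def rank_one_def dihedral_sign_def csmult_minus_one A.minus_eq
    A.a_ac
  show "twisted_deriv (u i 1) (u i 2) (u i 1 \<ominus> u i 2)"
    using twisted_deriv_u_sum[of i 1] i by (simp add: simps del: One_nat_def)
  show "twisted_deriv (u i 2) (u i 1) (u i 2 \<ominus> u i 1)"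
    using twisted_deriv_u_sum[of i 2] i by (simp add: simps del: One_nat_def)
  show "twisted_deriv (u i 3) (u i 4) (u i 4 \<ominus> u i 3)"
    using twisted_deriv_u_sum[of i 3] i by (simp add: simps del: One_nat_def)
  show "twisted_deriv (u i 4) (u i 3) (u i 3 \<ominus> u i 4)"
    using twisted_deriv_u_sum[of i 4] i by (simp add: simps del: One_nat_def)
qed

lemma u_orth:
  assumes "i \<in> {1..4}" "j \<in> {1..4}" "k \<in> {1..4}" "j \<noteq> k"
  shows "u i j \<otimes> u i k = \<zero>" "u j i \<otimes> u k i = \<zero>"
  using magic assms by (simp_all add: magic_unitary_def)

lemma u_idem: "\<lbrakk>i \<in> {1..4}; j \<in> {1..4}\<rbrakk> \<Longrightarrow> u i j \<otimes> u i j = u i j"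
  using magic by (simp add: magic_unitary_def projection_def)

lemma u_sum:
  assumes "i \<in> {1..4}"
  shows "u i 1 \<oplus> (u i 2 \<oplus> (u i 3 \<oplus> u i 4)) = \<one>" "u 1 i \<oplus> (u 2 i \<oplus> (u 3 i \<oplus> u 4 i)) = \<one>"
proof -
  have "(\<Oplus>j\<in>{1..4}. u i j) = \<one>" "(\<Oplus>j\<in>{1..4}. u j i) = \<one>"
    using magic assms by (simp_all add: magic_unitary_def)
  then show "u i 1 \<oplus> (u i 2 \<oplus> (u i 3 \<oplus> u i 4)) = \<one>" "u 1 i \<oplus> (u 2 i \<oplus> (u 3 i \<oplus> u 4 i)) = \<one>"
    using assms by (simp_all add: A.finsum_1_4 u_closed del: One_nat_def)
qed

text \<open>\<open>haar_moment_recursion\<close> for the two diagonal blocks; orthogonality holds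
  because each product pairs distinct entries of one row or one column.\<close>

lemma fix_sum_moments:
  fixes k n :: nat
  defines "D \<equiv> (u 1 1 \<oplus> u 2 2) \<oplus> (u 3 3 \<oplus> u 4 4)"
    and "Z \<equiv> (u 1 1 \<oplus> u 2 2) \<oplus> (u 1 2 \<oplus> u 2 1)"
  shows "(2 * of_nat k + 1) * h (D [^] k \<otimes> Z [^] Suc n) = (of_nat k + 1) * h (D [^] Suc k \<otimes> Z [^] n)"
    and "h (Z [^] n \<otimes> (u 1 1 \<oplus> u 2 2)) = h (Z [^] Suc n) / 2"
    and "h (D [^] k \<otimes> ((u 1 2 \<oplus> u 2 1) \<oplus> (u 3 4 \<oplus> u 4 3))) =
       2 * h (D [^] k \<otimes> Z) - h (D [^] Suc k)"
    and "(u 1 1 \<oplus> u 2 2) [^] Suc n = Z [^] n \<otimes> (u 1 1 \<oplus> u 2 2)"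
    and "Z \<in> carrier A" "D \<in> carrier A"
proof -
  let ?a = "u 1 1 \<oplus> u 2 2" and ?b = "u 3 3 \<oplus> u 4 4" and ?c = "u 1 2 \<oplus> u 2 1" and ?d = "u 3 4 \<oplus> u 4 3"
  have cl: "u i j \<in> carrier A" if "i \<in> {1, 2, 3, 4}" "j \<in> {1, 2, 3, 4}" for i j
    using u_closed that unfolding atLeastAtMost_1_4 by blast
  note [simp] = cl and [simp del] = One_nat_def
  have orth: "?a \<otimes> ?c = \<zero>" "?c \<otimes> ?a = \<zero>" "?b \<otimes> ?d = \<zero>" "?d \<otimes> ?b = \<zero>"
    by (simp_all add: A.l_distr A.r_distr u_orth)
  have diffs: "(x \<ominus> y) \<oplus> (x' \<ominus> y') = (x \<oplus> x') \<ominus> (y \<oplus> y')"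
    if "x \<in> carrier A" "y \<in> carrier A" "x' \<in> carrier A" "y' \<in> carrier A" for x y x' y'
    using that by (simp add: A.minus_eq A.minus_add A.a_ac)
  have a: "twisted_deriv ?a ?c (?a \<ominus> ?c)"
    using twisted_deriv_add[OF twisted_deriv_u(1)[of 1] twisted_deriv_u(2)[of 2]] by (simp add: diffs)
  have c: "twisted_deriv ?c ?a (?c \<ominus> ?a)"
    using twisted_deriv_add[OF twisted_deriv_u(2)[of 1] twisted_deriv_u(1)[of 2]] by (simp add: diffs)
  have b: "twisted_deriv ?b ?d (?d \<ominus> ?b)"
    using twisted_deriv_add[OF twisted_deriv_u(3)[of 3] twisted_deriv_u(4)[of 4]] by (simp add: diffs)
  have d: "twisted_deriv ?d ?b (?b \<ominus> ?d)"
    using twisted_deriv_add[OF twisted_deriv_u(4)[of 3] twisted_deriv_u(3)[of 4]] by (simp add: diffs)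
  \<comment> \<open>Rows 1 and 2 together, like columns 3 and 4 together, sum up to 2. Both contain
    the upper right block \<open>?x\<close>, which is cancelled.\<close>
  have eq: "?a \<oplus> ?c = ?b \<oplus> ?d"
  proof -
    let ?x = "u 1 3 \<oplus> (u 1 4 \<oplus> (u 2 3 \<oplus> u 2 4))"
    have "(?a \<oplus> ?c) \<oplus> ?x = (u 1 1 \<oplus> (u 1 2 \<oplus> (u 1 3 \<oplus> u 1 4))) \<oplus> (u 2 1 \<oplus> (u 2 2 \<oplus> (u 2 3 \<oplus> u 2 4)))"
      by (simp add: A.a_ac)
    also have "\<dots> = (u 1 3 \<oplus> (u 2 3 \<oplus> (u 3 3 \<oplus> u 4 3))) \<oplus> (u 1 4 \<oplus> (u 2 4 \<oplus> (u 3 4 \<oplus> u 4 4)))"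
      by (simp add: u_sum)
    also have "\<dots> = (?b \<oplus> ?d) \<oplus> ?x"
      by (simp add: A.a_ac)
    finally show ?thesis
      by simp
  qed
  note rec = haar_moment_recursion[OF a c b d orth eq, folded D_def Z_def]
  show "(2 * of_nat k + 1) * h (D [^] k \<otimes> Z [^] Suc n) = (of_nat k + 1) * h (D [^] Suc k \<otimes> Z [^] n)"
    "h (Z [^] n \<otimes> ?a) = h (Z [^] Suc n) / 2"
    "h (D [^] k \<otimes> (?c \<oplus> ?d)) = 2 * h (D [^] k \<otimes> Z) - h (D [^] Suc k)"
    by (rule rec)+
  show Z: "Z \<in> carrier A" and "D \<in> carrier A"
    by (simp_all add: Z_def D_def)
  have Za: "Z \<otimes> ?a = ?a \<otimes> ?a"
    unfolding Z_def by (rule A.split_projections(1)[OF _ _ _ _ orth eq]) simp_all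
  show "?a [^] Suc n = Z [^] n \<otimes> ?a"
  proof (induction n)
    case (Suc n)
    have "?a [^] Suc (Suc n) = (Z [^] n \<otimes> ?a) \<otimes> ?a"
      using Suc by simp
    then show ?case
      using Z by (simp add: A.m_assoc Za[symmetric])
  qed simp
qed

end

section \<open>Relabelling the points\<close>

lemma magic_unitary_relabel:
  assumes "abelian_monoid A" and u: "magic_unitary n A u" and \<sigma>: "bij_betw \<sigma> {1..n} {1..n}"
  shows "magic_unitary n A (\<lambda>i j. u (\<sigma> i) (\<sigma> j))"
proof -
  interpret abelian_monoid A by fact
  have mem: "\<sigma> i \<in> {1..n}" if "i \<in> {1..n}" for i
    using bij_betwE[OF \<sigma>] that by blast
  have inj: "\<sigma> i \<noteq> \<sigma> j" if "i \<in> {1..n}" "j \<in> {1..n}" "i \<noteq> j" for i j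
    using inj_on_eq_iff[OF bij_betw_imp_inj_on[OF \<sigma>]] that by blast
  have closed: "u i j \<in> carrier A" if "i \<in> {1..n}" "j \<in> {1..n}" for i j
    using u that by (simp add: magic_unitary_def projection_def)
  have sum: "(\<Oplus>\<^bsub>A\<^esub>j\<in>{1..n}. f (\<sigma> j)) = (\<Oplus>\<^bsub>A\<^esub>j\<in>{1..n}. f j)"
    if "f \<in> {1..n} \<rightarrow> carrier A" for f
    using finsum_reindex[of f \<sigma> "{1..n}"] that
    by (simp only: bij_betw_imp_surj_on[OF \<sigma>] bij_betw_imp_inj_on[OF \<sigma>])
  show ?thesis
    unfolding magic_unitary_def
  proof (intro conjI ballI impI)
    fix i assume i: "i \<in> {1..n}"
    show "(\<Oplus>\<^bsub>A\<^esub>j\<in>{1..n}. u (\<sigma> i) (\<sigma> j)) = \<one>\<^bsub>A\<^esub>"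
      using sum[of "\<lambda>j. u (\<sigma> i) j"] closed mem[OF i] u by (simp add: magic_unitary_def Pi_iff)
    show "(\<Oplus>\<^bsub>A\<^esub>j\<in>{1..n}. u (\<sigma> j) (\<sigma> i)) = \<one>\<^bsub>A\<^esub>"
      using sum[of "\<lambda>j. u j (\<sigma> i)"] closed mem[OF i] u by (simp add: magic_unitary_def Pi_iff)
  qed (use u mem inj in \<open>simp_all add: magic_unitary_def\<close>)
qed

text \<open>To hit a target w with the relabelled generators, use the universal property of
  \<open>u\<close> for w relabelled by the inverse permutation.\<close>

lemma quantum_permutation_algebra_relabel:
  assumes u: "quantum_permutation_algebra n A u" and \<sigma>: "bij_betw \<sigma> {1..n} {1..n}"
  shows "quantum_permutation_algebra n A (\<lambda>i j. u (\<sigma> i) (\<sigma> j))"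
proof -
  let ?v = "\<lambda>i j. u (\<sigma> i) (\<sigma> j)"
  have surj: "\<sigma> ` {1..n} = {1..n}"
    using \<sigma> by (rule bij_betw_imp_surj_on)
  define \<tau> where "\<tau> = inv_into {1..n} \<sigma>"
  have \<tau>: "bij_betw \<tau> {1..n} {1..n}"
    unfolding \<tau>_def using \<sigma> by (rule bij_betw_inv_into)
  have \<tau>\<sigma>: "\<tau> (\<sigma> i) = i" if "i \<in> {1..n}" for i
    unfolding \<tau>_def using \<sigma> that by (simp add: bij_betw_inv_into_left)
  have mem: "\<sigma> i \<in> {1..n}" if "i \<in> {1..n}" for i
    using surj that by blast
  have monoid: "abelian_monoid B" if "cstar_algebra B" for B :: "'c cstar"
    using that cstar_algebra.axioms(1) ring.is_abelian_group abelian_group.axioms(1) by blast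
  have gens: "{?v i j |i j. i \<in> {1..n} \<and> j \<in> {1..n}} = {u i j |i j. i \<in> {1..n} \<and> j \<in> {1..n}}"
  proof (intro equalityI subsetI)
    fix x assume "x \<in> {u i j |i j. i \<in> {1..n} \<and> j \<in> {1..n}}"
    then obtain i j where "x = u i j" "i \<in> \<sigma> ` {1..n}" "j \<in> \<sigma> ` {1..n}"
      unfolding surj by blast
    then show "x \<in> {?v i j |i j. i \<in> {1..n} \<and> j \<in> {1..n}}" by blast
  qed (use mem in blast)
  have univ: "\<exists>f. star_hom A B f \<and> (\<forall>i\<in>{1..n}. \<forall>j\<in>{1..n}. f (?v i j) = w i j)"
    if B: "cstar_algebra B" "magic_unitary n B w"
    for B :: "(nat \<Rightarrow> nat \<Rightarrow> complex) cstar" and w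
  proof -
    have "magic_unitary n B (\<lambda>i j. w (\<tau> i) (\<tau> j))"
      by (rule magic_unitary_relabel[OF monoid[OF B(1)] B(2) \<tau>])
    then obtain f where "star_hom A B f"
      "\<forall>i\<in>{1..n}. \<forall>j\<in>{1..n}. f (u i j) = w (\<tau> i) (\<tau> j)"
      using u B(1) unfolding quantum_permutation_algebra_def by blast
    then show ?thesis
      using \<tau>\<sigma> mem by (intro exI[of _ f]) simp
  qed
  show ?thesis
    unfolding quantum_permutation_algebra_def gens
    using u univ magic_unitary_relabel[OF monoid _ \<sigma>, of A u]
    by (simp add: quantum_permutation_algebra_def)
qed

text \<open>As rows and columns are permuted alike, the summation index k absorbs the
  permutation.\<close>

lemma comultiplication_relabel:
  assumes T: "abelian_monoid T" and ten: "\<And>x y. \<lbrakk>x \<in> carrier A; y \<in> carrier A\<rbrakk> \<Longrightarrow> ten x y \<in> carrier T"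
    and u: "\<And>i j. \<lbrakk>i \<in> {1..n}; j \<in> {1..n}\<rbrakk> \<Longrightarrow> u i j \<in> carrier A"
    and \<Delta>: "comultiplication n A u T ten \<Delta>" and \<sigma>: "bij_betw \<sigma> {1..n} {1..n}"
  shows "comultiplication n A (\<lambda>i j. u (\<sigma> i) (\<sigma> j)) T ten \<Delta>"
proof -
  interpret abelian_monoid T by fact
  have mem: "\<sigma> i \<in> {1..n}" if "i \<in> {1..n}" for i
    using bij_betwE[OF \<sigma>] that by blast
  have "\<Delta> (u (\<sigma> i) (\<sigma> j)) = (\<Oplus>\<^bsub>T\<^esub>k\<in>{1..n}. ten (u (\<sigma> i) (\<sigma> k)) (u (\<sigma> k) (\<sigma> j)))"
    if ij: "i \<in> {1..n}" "j \<in> {1..n}" for i j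
  proof -
    let ?f = "\<lambda>k. ten (u (\<sigma> i) k) (u k (\<sigma> j))"
    have "?f \<in> {1..n} \<rightarrow> carrier T"
      using ten u mem[OF ij(1)] mem[OF ij(2)] by blast
    then have "finsum T ?f {1..n} = (\<Oplus>\<^bsub>T\<^esub>k\<in>{1..n}. ?f (\<sigma> k))"
      using finsum_reindex[of ?f \<sigma> "{1..n}"]
      by (simp only: bij_betw_imp_surj_on[OF \<sigma>] bij_betw_imp_inj_on[OF \<sigma>])
    moreover have "\<Delta> (u (\<sigma> i) (\<sigma> j)) = finsum T ?f {1..n}"
      using \<Delta> mem[OF ij(1)] mem[OF ij(2)] by (simp add: comultiplication_def)
    ultimately show ?thesis by simp
  qed
  then show ?thesis
    using \<Delta> by (simp add: comultiplication_def)
qed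

text \<open>\<open>F\<close> and \<open>\<pi>\<close> are left out so that the locale can be
  re-entered with relabelled generators, each labelling having its own \<open>\<pi>\<close>.\<close>

locale qperm4 =
  fixes A :: "'a cstar" (structure) and T :: "'t cstar" and ten :: "'a \<Rightarrow> 'a \<Rightarrow> 't"
    and \<Delta> :: "'a \<Rightarrow> 't" and h :: "'a \<Rightarrow> complex" and u :: "nat \<Rightarrow> nat \<Rightarrow> 'a"
  assumes qperm: "quantum_permutation_algebra 4 A u"
    and tensor: "tensor_completion A A T ten"
    and comult: "comultiplication 4 A u T ten \<Delta>"
    and haar: "haar_functional A T ten \<Delta> h"
begin

text \<open>For each t the universal property supplies a homomorphism, with no link between
  different t; dependence on t is controlled through the values on the generators.\<close>

lemma ex_qperm4_model: "\<exists>F \<pi>. qperm4_model A T ten \<Delta> h F \<pi> u"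
proof -
  obtain F where F: "slice_left A A T ten h F" "\<And>a. a \<in> carrier A \<Longrightarrow> F (\<Delta> a) = h a \<odot> \<one>"
    using haar by (auto simp: haar_functional_def)
  have "\<forall>t. \<exists>f. star_hom A (mat_cstar TYPE(2)) f \<and>
      (\<forall>i\<in>{1..4}. \<forall>j\<in>{1..4}. f (u i j) = mat_code (dihedral_model t i j))"
    by (intro allI qperm[unfolded quantum_permutation_algebra_def, THEN conjunct2, THEN conjunct2,
          THEN conjunct2, THEN spec, THEN spec, THEN mp] conjI cstar_algebra_mat magic_unitary_dihedral_model)
  then obtain f where f: "\<And>t. star_hom A (mat_cstar TYPE(2)) (f t)"
      "\<And>t i j. \<lbrakk>i \<in> {1..4}; j \<in> {1..4}\<rbrakk> \<Longrightarrow> f t (u i j) = mat_code (dihedral_model t i j)"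
    by metis
  define \<pi> where "\<pi> t x = (mat_decode (f t x) :: complex^2^2)" for t x
  note hom = f(1)[unfolded star_hom_def ring_hom_def clinear_map_def]
  have "haar_setup A T ten \<Delta> h F \<pi>"
  proof
    show "\<pi> t (x \<otimes> y) = \<pi> t x ** \<pi> t y" if "x \<in> carrier A" "y \<in> carrier A" for t x y
      using hom[of t] that by (simp add: \<pi>_def mat_cstar_def)
    show "\<pi> t (x \<oplus> y) = \<pi> t x + \<pi> t y" if "x \<in> carrier A" "y \<in> carrier A" for t x y
      using hom[of t] that by (simp add: \<pi>_def mat_cstar_def)
    show "\<pi> t \<one> = mat 1" for t
      using hom[of t] by (simp add: \<pi>_def mat_cstar_def)
    show "\<pi> t (c \<odot> x) = (\<chi> i j. c * \<pi> t x $ i $ j)" if "x \<in> carrier A" for t c x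
      using hom[of t] that by (simp add: \<pi>_def mat_cstar_def)
    show "star_hom A T \<Delta>" "state A h"
      using comult haar by (simp_all add: comultiplication_def haar_functional_def)
  qed (fact tensor F)+
  moreover have "qperm4_model_axioms A T ten \<Delta> \<pi> u"
  proof
    show "magic_unitary 4 A u"
      using qperm by (simp add: quantum_permutation_algebra_def)
    show "\<Delta> (u i j) = (\<Oplus>\<^bsub>T\<^esub>k\<in>{1..4}. ten (u i k) (u k j))" if "i \<in> {1..4}" "j \<in> {1..4}" for i j
      using comult that by (simp add: comultiplication_def)
    show "\<pi> t (u i j) = dihedral_model t i j" if "i \<in> {1..4}" "j \<in> {1..4}" for t i j
      unfolding \<pi>_def f(2)[OF that] by simp
  qed
  ultimately have "qperm4_model A T ten \<Delta> h F \<pi> u"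
    by (rule qperm4_model.intro)
  then show ?thesis by (intro exI)
qed

lemma qperm4_relabel:
  assumes "bij_betw \<sigma> {1..4} {1..4}"
  shows "qperm4 A T ten \<Delta> h (\<lambda>i j. u (\<sigma> i) (\<sigma> j))"
proof -
  obtain F \<pi> where "qperm4_model A T ten \<Delta> h F \<pi> u"
    using ex_qperm4_model by (elim exE)
  then interpret qperm4_model A T ten \<Delta> h F \<pi> u .
  show ?thesis
  proof
    show "quantum_permutation_algebra 4 A (\<lambda>i j. u (\<sigma> i) (\<sigma> j))"
      by (rule quantum_permutation_algebra_relabel[OF qperm assms])
    show "comultiplication 4 A (\<lambda>i j. u (\<sigma> i) (\<sigma> j)) T ten \<Delta>"
      by (rule comultiplication_relabel[OF T.A.abelian_monoid_axioms ten_closed u_closed comult assms])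
  qed (fact tensor haar)+
qed

end

section \<open>Solving the moment recursions\<close>

context qperm4
begin

abbreviation "fix_sum \<equiv> (u 1 1 \<oplus> u 2 2) \<oplus> (u 3 3 \<oplus> u 4 4)"
abbreviation "block_sum \<equiv> (u 1 1 \<oplus> u 2 2) \<oplus> (u 1 2 \<oplus> u 2 1)"

text \<open>Eliminating h (D^k Z) removes \<open>block_sum\<close>, which a relabelling may change,
  and leaves a relation whose left factor \<open>fix_sum\<close> is the same for all
  labellings.\<close>

lemma offdiagonal_moment:
  "(2 * of_nat k + 1) * h (fix_sum [^] k \<otimes> ((u 1 2 \<oplus> u 2 1) \<oplus> (u 3 4 \<oplus> u 4 3))) = h (fix_sum [^] Suc k)"
proof -
  obtain F \<pi> where "qperm4_model A T ten \<Delta> h F \<pi> u"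
    using ex_qperm4_model by (elim exE)
  then interpret qperm4_model A T ten \<Delta> h F \<pi> u .
  have "(2 * of_nat k + 1) * h (fix_sum [^] k \<otimes> block_sum) = (of_nat k + 1) * h (fix_sum [^] Suc k)"
    using fix_sum_moments(1)[of k 0] fix_sum_moments(5,6) by simp
  then show ?thesis
    unfolding fix_sum_moments(3) by (simp add: algebra_simps)
qed

text \<open>The sixteen entries, of total sum 4, fall into four groups: the diagonal and the graphs
  of the three double transpositions. Each of the latter contributes m / r, so 4 r h (D^k) = (r + 3)
  m.\<close>

lemma fix_sum_recursion:
  "(of_nat k + 2) * h (fix_sum [^] Suc k) = 2 * (2 * of_nat k + 1) * h (fix_sum [^] k)"
proof -
  obtain F \<pi> where "qperm4_model A T ten \<Delta> h F \<pi> u"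
    using ex_qperm4_model by (elim exE)
  then interpret qperm4_model A T ten \<Delta> h F \<pi> u .
  have cl: "u i j \<in> carrier A" if "i \<in> {1, 2, 3, 4}" "j \<in> {1, 2, 3, 4}" for i j
    using u_closed that unfolding atLeastAtMost_1_4 by blast
  note [simp] = cl and [simp del] = One_nat_def
  define g where "g i j = h (fix_sum [^] k \<otimes> u i j)" for i j
  define m where "m = h (fix_sum [^] Suc k)"
  define r where "r = 2 * of_nat k + (1 :: complex)"
  have row: "g i 1 + (g i 2 + (g i 3 + g i 4)) = h (fix_sum [^] k)" if "i \<in> {1, 2, 3, 4}" for i
  proof -
    have i: "i \<in> {1..4}"
      using that unfolding atLeastAtMost_1_4 .
    have "h (fix_sum [^] k \<otimes> (u i 1 \<oplus> (u i 2 \<oplus> (u i 3 \<oplus> u i 4)))) = h (fix_sum [^] k)"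
      unfolding u_sum(1)[OF i] by simp
    then show ?thesis
      using that by (simp add: A.r_distr[of _ _ "fix_sum [^] k"] h_add g_def)
  qed
  have split: "h (fix_sum [^] k \<otimes> ((u i j \<oplus> u i' j') \<oplus> (u i'' j'' \<oplus> u i''' j'''))) =
      (g i j + g i' j') + (g i'' j'' + g i''' j''')"
    if "{i, i', i'', i''', j, j', j'', j'''} \<subseteq> {1, 2, 3, 4}" for i i' i'' i''' j j' j'' j'''
    using that by (simp add: A.r_distr[of _ _ "fix_sum [^] k"] h_add g_def)
  have diag: "(g 1 1 + g 2 2) + (g 3 3 + g 4 4) = m"
    unfolding m_def A.nat_pow_Suc by (subst split) simp_all
  have off2: "r * ((g 1 2 + g 2 1) + (g 3 4 + g 4 3)) = m"
    using offdiagonal_moment[of k] by (simp add: split r_def m_def del: A.nat_pow_Suc)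
  have off3: "r * ((g 1 3 + g 3 1) + (g 2 4 + g 4 2)) = m"
  proof -
    \<comment> \<open>Exchanging 2 and 3 carries (1 2)(3 4) to (1 3)(2 4).\<close>
    define \<sigma> :: "nat \<Rightarrow> nat" where "\<sigma> = id(2 := 3, 3 := 2)"
    have "bij_betw \<sigma> {1..4} {1..4}"
      by (rule bij_betw_byWitness[of _ \<sigma>]) (auto simp: \<sigma>_def)
    then interpret R: qperm4 A T ten \<Delta> h "\<lambda>i j. u (\<sigma> i) (\<sigma> j)"
      by (rule qperm4_relabel)
    have "(u 1 1 \<oplus> u 3 3) \<oplus> (u 2 2 \<oplus> u 4 4) = fix_sum"
      by (simp add: A.a_ac)
    then show ?thesis
      using R.offdiagonal_moment[of k] by (simp add: \<sigma>_def split r_def m_def del: A.nat_pow_Suc)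
  qed
  have off4: "r * ((g 1 4 + g 4 1) + (g 3 2 + g 2 3)) = m"
  proof -
    \<comment> \<open>Exchanging 2 and 4 carries (1 2)(3 4) to (1 4)(2 3).\<close>
    define \<sigma> :: "nat \<Rightarrow> nat" where "\<sigma> = id(2 := 4, 4 := 2)"
    have "bij_betw \<sigma> {1..4} {1..4}"
      by (rule bij_betw_byWitness[of _ \<sigma>]) (auto simp: \<sigma>_def)
    then interpret R: qperm4 A T ten \<Delta> h "\<lambda>i j. u (\<sigma> i) (\<sigma> j)"
      by (rule qperm4_relabel)
    have "(u 1 1 \<oplus> u 4 4) \<oplus> (u 3 3 \<oplus> u 2 2) = fix_sum"
      by (simp add: A.a_ac)
    then show ?thesis
      using R.offdiagonal_moment[of k] by (simp add: \<sigma>_def split r_def m_def del: A.nat_pow_Suc)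
  qed
  have "4 * h (fix_sum [^] k) = (\<Sum>i\<in>{1, 2, 3, 4}. g i 1 + (g i 2 + (g i 3 + g i 4)))"
    by (simp add: row)
  also have "\<dots> = ((g 1 1 + g 2 2) + (g 3 3 + g 4 4)) + ((g 1 2 + g 2 1) + (g 3 4 + g 4 3)) +
      ((g 1 3 + g 3 1) + (g 2 4 + g 4 2)) + ((g 1 4 + g 4 1) + (g 3 2 + g 2 3))"
    by simp
  finally have "r * (4 * h (fix_sum [^] k)) = r * m + m + m + m"
    unfolding diag by (simp only: distrib_left[of r] off2[unfolded distrib_left] off3[unfolded distrib_left]
        off4[unfolded distrib_left])
  then have "2 * ((of_nat k + 2) * m) = 2 * (2 * r * h (fix_sum [^] k))"
    by (simp add: r_def algebra_simps)
  then show ?thesis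
    unfolding r_def m_def by simp
qed

text \<open>Trading the factors D for Z one at a time gives h (D^k) = r k h (Z^k). Substituting this
  into \<open>fix_sum_recursion\<close> and cancelling the nonzero r leaves a recursion for h (Z^n)
  alone.\<close>

lemma block_moment: "h (block_sum [^] n) = 2 ^ n / (of_nat n + 1)"
proof -
  obtain F \<pi> where "qperm4_model A T ten \<Delta> h F \<pi> u"
    using ex_qperm4_model by (elim exE)
  then interpret qperm4_model A T ten \<Delta> h F \<pi> u .
  define r :: "nat \<Rightarrow> complex" where "r k = (\<Prod>j<k. (2 * of_nat j + 1) / (of_nat j + 1))" for k
  have nz: "2 * of_nat j + (1 :: complex) \<noteq> 0" "of_nat j + (1 :: complex) \<noteq> 0" "of_nat j + (2 :: complex) \<noteq> 0" for j
  proof -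
    have "of_nat (2 * j + 1) \<noteq> (0 :: complex)" "of_nat (j + 1) \<noteq> (0 :: complex)" "of_nat (j + 2) \<noteq> (0 :: complex)"
      by (simp_all only: of_nat_eq_0_iff)
    then show "2 * of_nat j + (1 :: complex) \<noteq> 0" "of_nat j + (1 :: complex) \<noteq> 0" "of_nat j + (2 :: complex) \<noteq> 0"
      by (simp_all add: add.commute)
  qed
  have r_nz: "r k \<noteq> 0" for k
    using nz by (simp add: r_def)
  have mixed: "h (fix_sum [^] k \<otimes> block_sum [^] n) = r k * h (block_sum [^] (n + k))" for k n
  proof (induction k arbitrary: n)
    case (Suc k)
    have "(of_nat k + 1) * h (fix_sum [^] Suc k \<otimes> block_sum [^] n) =
        (2 * of_nat k + 1) * h (fix_sum [^] k \<otimes> block_sum [^] Suc n)"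
      using fix_sum_moments(1) by simp
    also have "\<dots> = (2 * of_nat k + 1) * (r k * h (block_sum [^] (n + Suc k)))"
      unfolding Suc by simp
    finally show ?case
      using nz(2)[of k] by (simp add: r_def field_simps del: A.nat_pow_Suc)
  qed (use fix_sum_moments(5) in \<open>simp add: r_def\<close>)
  have fix_sum: "h (fix_sum [^] k) = r k * h (block_sum [^] k)" for k
    using mixed[of k 0] fix_sum_moments(6) by simp
  have step: "(of_nat n + 2) * h (block_sum [^] Suc n) = 2 * (of_nat n + 1) * h (block_sum [^] n)" for n
  proof -
    have "(of_nat n + 2) * (r (Suc n) * h (block_sum [^] Suc n)) = 2 * (2 * of_nat n + 1) * (r n * h (block_sum [^] n))"
      using fix_sum_recursion[of n] unfolding fix_sum .
    moreover have "r (Suc n) = r n * (2 * of_nat n + 1) / (of_nat n + 1)"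
      by (simp add: r_def)
    ultimately have "(r n * (2 * of_nat n + 1)) * ((of_nat n + 2) * h (block_sum [^] Suc n)) =
        (r n * (2 * of_nat n + 1)) * (2 * (of_nat n + 1) * h (block_sum [^] n))"
      using nz(2)[of n] by (simp add: field_simps del: A.nat_pow_Suc)
    then show ?thesis
      using r_nz[of n] nz(1)[of n] by simp
  qed
  show ?thesis
  proof (induction n)
    case (Suc n)
    have "(of_nat n + 2) * h (block_sum [^] Suc n) = 2 * ((of_nat n + 1) * (2 ^ n / (of_nat n + 1)))"
      unfolding step Suc by (rule mult.assoc)
    also have "\<dots> = 2 ^ Suc n"
      using nz(2)[of n] by simp
    finally have "h (block_sum [^] Suc n) = 2 ^ Suc n / (of_nat n + 2)"
      using nz(3)[of n] by (simp add: eq_divide_eq mult.commute del: A.nat_pow_Suc)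
    then show ?case
      by (simp add: add.commute del: A.nat_pow_Suc)
  qed (simp add: h_one)
qed

lemma corner_moment: "h ((u 1 1 \<oplus> u 2 2) [^] Suc n) = 2 ^ n / (of_nat n + 2)"
proof -
  obtain F \<pi> where "qperm4_model A T ten \<Delta> h F \<pi> u"
    using ex_qperm4_model by (elim exE)
  then interpret qperm4_model A T ten \<Delta> h F \<pi> u .
  have "complex_of_nat (Suc n) + 1 = of_nat n + 2"
    by simp
  moreover have "2 ^ Suc n / x / 2 = 2 ^ n / x" for x :: complex
    by simp
  ultimately show ?thesis
    unfolding fix_sum_moments(4) fix_sum_moments(2) block_moment by metis
qed

text \<open>Relabelling \<open>corner_moment\<close> shows that h of any two diagonal entries adds
  up to 1/2; the three pairs among \<open>u 1 1\<close>, \<open>u 2 2\<close>, \<open>u 3 3\<close>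
  determine each value.\<close>

lemma entry_moment: "h (u 1 1) = 1 / 4"
proof -
  obtain F \<pi> where "qperm4_model A T ten \<Delta> h F \<pi> u"
    using ex_qperm4_model by (elim exE)
  then interpret qperm4_model A T ten \<Delta> h F \<pi> u .
  have two: "h (u 1 1) + h (u 2 2) = 1 / 2"
    using corner_moment[of 0] by (simp add: h_add u_closed del: One_nat_def)
  have three: "h (u 1 1) + h (u 3 3) = 1 / 2"
  proof -
    define \<sigma> :: "nat \<Rightarrow> nat" where "\<sigma> = id(2 := 3, 3 := 2)"
    have "bij_betw \<sigma> {1..4} {1..4}"
      by (rule bij_betw_byWitness[of _ \<sigma>]) (auto simp: \<sigma>_def)
    then interpret R: qperm4 A T ten \<Delta> h "\<lambda>i j. u (\<sigma> i) (\<sigma> j)"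
      by (rule qperm4_relabel)
    show ?thesis
      using R.corner_moment[of 0] by (simp add: \<sigma>_def h_add u_closed del: One_nat_def)
  qed
  have rest: "h (u 3 3) + h (u 2 2) = 1 / 2"
  proof -
    define \<sigma> :: "nat \<Rightarrow> nat" where "\<sigma> = id(1 := 3, 3 := 1)"
    have "bij_betw \<sigma> {1..4} {1..4}"
      by (rule bij_betw_byWitness[of _ \<sigma>]) (auto simp: \<sigma>_def)
    then interpret R: qperm4 A T ten \<Delta> h "\<lambda>i j. u (\<sigma> i) (\<sigma> j)"
      by (rule qperm4_relabel)
    show ?thesis
      using R.corner_moment[of 0] by (simp add: \<sigma>_def h_add u_closed del: One_nat_def)
  qed
  have "h (u 1 1) = ((h (u 1 1) + h (u 2 2)) + (h (u 1 1) + h (u 3 3)) - (h (u 3 3) + h (u 2 2))) / 2"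
    by simp
  then show ?thesis
    unfolding two three rest by simp
qed

end


section \<open>Moments of the limiting measures\<close>

context
  fixes p :: real and M N :: "'a measure"
  assumes p: "0 \<le> p" "p \<le> 1" and M: "prob_space M" and N: "prob_space N"
    and sets_eq: "sets N = sets M"
begin

lemma mixture_kernel:
  "(\<lambda>b. if b then N else M) \<in> measurable (measure_pmf (bernoulli_pmf p)) (subprob_algebra M)"
  using prob_space_imp_subprob_space[OF M] prob_space_imp_subprob_space[OF N] sets_eq
  by (simp add: space_subprob_algebra Pi_iff)

text \<open>As a Bernoulli choice between M and N, the mixture inherits countable additivity,
  integrals and null sets from \<open>bind\<close>.\<close>

lemma mixture_eq_bind:
  "mixture p M N = measure_pmf (bernoulli_pmf p) \<bind> (\<lambda>b. if b then N else M)" (is "_ = ?B")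
proof -
  have sets_B: "sets ?B = sets M"
    by (rule sets_bind_measurable[OF mixture_kernel]) simp
  have emeasure_B: "ennreal (1 - p) * emeasure M E + ennreal p * emeasure N E = emeasure ?B E"
    if "E \<in> sets M" for E
    using emeasure_bind[OF _ mixture_kernel that] nn_integral_bernoulli_pmf[OF p]
    by (simp add: mult.commute add.commute)
  have "mixture p M N = measure_of (space M) (sets M) (emeasure ?B)"
    unfolding mixture_def
    by (rule measure_of_eq[OF sets.space_closed]) (simp only: sets.sigma_sets_eq emeasure_B)
  also have "\<dots> = ?B"
    using measure_of_of_measure[of ?B] unfolding sets_B sets_eq_imp_space_eq[OF sets_B] .
  finally show ?thesis .
qed

lemma sets_mixture: "sets (mixture p M N) = sets M"
  unfolding mixture_eq_bind by (rule sets_bind_measurable[OF mixture_kernel]) simp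

lemma prob_space_mixture: "prob_space (mixture p M N)"
  unfolding mixture_eq_bind using M N
  by (intro measure_pmf.prob_space_bind[OF _ mixture_kernel]) simp

lemma nn_integral_mixture:
  "f \<in> borel_measurable M \<Longrightarrow> (\<integral>\<^sup>+x. f x \<partial>mixture p M N) =
     ennreal (1 - p) * (\<integral>\<^sup>+x. f x \<partial>M) + ennreal p * (\<integral>\<^sup>+x. f x \<partial>N)"
  unfolding mixture_eq_bind using nn_integral_bind[OF _ mixture_kernel] nn_integral_bernoulli_pmf[OF p]
  by (simp add: mult.commute add.commute)

lemma AE_mixture:
  assumes "AE x in M. P x" "AE x in N. P x" "{x \<in> space M. P x} \<in> sets M"
  shows "AE x in mixture p M N. P x"
  unfolding mixture_eq_bind using assms sets_eq
  by (subst AE_bind[OF mixture_kernel]) (auto simp: pred_def)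

end

text \<open>The atom at 0 adds nothing to positive moments, and the zeroth moment is the total mass.
  Nonnegative integrals suffice because the mixture lives on [0, 1].\<close>

lemma is_law_mixtureI:
  assumes p: "0 \<le> p" "p \<le> 1" and N: "prob_space N" "sets N = sets borel" "AE x in N. x \<in> {0..1}"
    and moments: "\<And>k. (\<integral>\<^sup>+x. ennreal (x ^ k) \<partial>N) = ennreal (m k)" "\<And>k. 0 \<le> m k"
    and h: "h \<one>\<^bsub>A\<^esub> = 1" "\<And>k. h (a [^]\<^bsub>A\<^esub> Suc k) = complex_of_real (p * m (Suc k))"
  shows "is_law A h a (mixture p (return borel 0) N)"
proof -
  let ?Q = "mixture p (return borel 0) N"
  have R: "prob_space (return borel (0::real))" "sets N = sets (return borel 0)"
    using N by (simp_all add: prob_space_return)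
  note Q = p R(1) N(1) R(2)
  have sets [measurable_cong]: "sets ?Q = sets borel"
    by (simp add: sets_mixture[OF Q])
  interpret prob_space ?Q
    by (rule prob_space_mixture[OF Q])
  have AE: "AE x in ?Q. x \<in> {0..1}"
    by (rule AE_mixture[OF Q _ N(3)]) (simp_all add: AE_return)
  have integral: "(\<integral>x. x ^ k \<partial>?Q) = (1 - p) * 0 ^ k + p * m k" for k
  proof -
    have "(\<integral>x. x ^ k \<partial>?Q) = enn2real (\<integral>\<^sup>+x. ennreal (x ^ k) \<partial>?Q)"
      by (rule integral_eq_nn_integral) (use AE in \<open>auto\<close>)
    also have "(\<integral>\<^sup>+x. ennreal (x ^ k) \<partial>?Q) = ennreal (1 - p) * ennreal (0 ^ k) + ennreal p * ennreal (m k)"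
      by (subst nn_integral_mixture[OF Q]) (simp_all add: nn_integral_return moments)
    also have "\<dots> = ennreal ((1 - p) * 0 ^ k + p * m k)"
      using p moments(2) by (simp add: ennreal_mult ennreal_plus)
    also have "enn2real \<dots> = (1 - p) * 0 ^ k + p * m k"
      using p moments(2) by (subst enn2real_ennreal) (auto intro!: add_nonneg_nonneg mult_nonneg_nonneg)
    finally show ?thesis .
  qed
  have "complex_of_real (\<integral>x. x ^ k \<partial>?Q) = h (a [^]\<^bsub>A\<^esub> k)" for k
  proof (cases k)
    case 0
    then show ?thesis by (simp add: h(1) prob_space)
  next
    case (Suc l)
    then show ?thesis unfolding integral Suc h(2) by simp
  qed
  moreover have "real_distribution ?Q"
    using sets sets_eq_imp_space_eq[OF sets] by unfold_locales simp_all
  ultimately show ?thesis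
    unfolding is_law_def using AE by (intro conjI exI[of _ "{0..1}"] allI) simp_all
qed

section \<open>Explicit moments of the three measures\<close>

lemma return_moment: "(\<integral>\<^sup>+x. ennreal (x ^ k) \<partial>return borel 1) = ennreal 1"
  by (subst nn_integral_return) simp_all

lemma lambda1_moment: "(\<integral>\<^sup>+x. ennreal (x ^ k) \<partial>lambda1) = ennreal (1 / (real k + 1))"
proof -
  have "((\<lambda>x. x ^ k) has_integral 1 ^ Suc k / real (Suc k) - 0 ^ Suc k / real (Suc k)) {0..1::real}"
  proof (rule fundamental_theorem_of_calculus)
    fix x :: real
    have "((\<lambda>x. x ^ Suc k / real (Suc k)) has_real_derivative x ^ k) (at x within {0..1})"
      using DERIV_cdivide[OF DERIV_pow[of "Suc k" x "{0..1}"], of "real (Suc k)"] by (simp del: of_nat_Suc)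
    then show "((\<lambda>x. x ^ Suc k / real (Suc k)) has_vector_derivative x ^ k) (at x within {0..1})"
      by (simp only: has_real_derivative_iff_has_vector_derivative)
  qed simp
  then have "((\<lambda>x. x ^ k) has_integral 1 / (real k + 1)) {0..1::real}"
    by (simp add: add.commute)
  from nn_integral_has_integral_lebesgue'[OF _ this] show ?thesis
    by (simp add: lambda1_def nn_integral_density mult.commute)
qed

text \<open>Writing the root as (1 - x)^(1/2) x^(-1/2) turns the moment into a Beta
  integral.\<close>

lemma nu1_moment:
  "(\<integral>\<^sup>+x. ennreal (x ^ k) \<partial>nu1) = ennreal (2 / pi * Beta (real k + 1 / 2) (3 / 2))"
proof -
  let ?f = "\<lambda>x. 2 / pi * (x powr (real k + 1 / 2 - 1) * (1 - x) powr (3 / 2 - 1))"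
  have "(?f has_integral 2 / pi * Beta (real k + 1 / 2) (3 / 2)) {0..1}"
    by (intro has_integral_mult_right has_integral_Beta_real) simp_all
  from nn_integral_has_integral_lebesgue'[OF _ this]
  have "(\<integral>\<^sup>+x. ennreal (?f x) * indicator {0..1} x \<partial>lborel) =
      ennreal (2 / pi * Beta (real k + 1 / 2) (3 / 2))"
    by simp
  moreover have "ennreal (2 / pi * sqrt (inverse x - 1)) * indicator {0..1} x * ennreal (x ^ k) =
      ennreal (?f x) * indicator {0..1} x" for x :: real
  proof (cases "0 < x \<and> x \<le> 1")
    case True
    have "sqrt (inverse x - 1) = (1 - x) powr (1 / 2) * x powr (- (1 / 2))"
    proof -
      have "inverse x - 1 = (1 - x) * inverse x"
        using True by (simp add: field_simps)
      moreover have "x powr (- (1 / 2)) = inverse (sqrt x)"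
        unfolding powr_minus using True by (subst powr_half_sqrt) simp_all
      moreover have "(1 - x) powr (1 / 2) = sqrt (1 - x)"
        using True by (intro powr_half_sqrt) simp
      ultimately show ?thesis
        by (simp only: real_sqrt_mult real_sqrt_inverse divide_inverse mult_1)
    qed
    moreover have "x powr (- (1 / 2)) * x ^ k = x powr (real k + 1 / 2 - 1)"
    proof -
      have "x powr (- (1 / 2)) * x powr real k = x powr (- (1 / 2) + real k)"
        by (rule powr_add[symmetric])
      moreover have "- (1 / 2) + real k = real k + 1 / 2 - 1"
        by simp
      ultimately show ?thesis
        using True by (simp only: powr_realpow)
    qed
    ultimately have eq: "2 / pi * sqrt (inverse x - 1) * x ^ k = ?f x"
      by (simp only: mult_ac) simp
    have "ennreal (2 / pi * sqrt (inverse x - 1)) * ennreal (x ^ k) = ennreal (?f x)"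
      unfolding eq[symmetric] using True by (intro ennreal_mult''[symmetric]) simp
    then show ?thesis
      using True by simp
  next
    case False
    \<comment> \<open>At x = 0, \<open>inverse 0 = 0\<close> puts a negative number under
      \<open>ennreal\<close>, giving 0, and \<open>0 powr _\<close> is 0 as well; elsewhere the
      indicator vanishes.\<close>
    then show ?thesis
      by (cases "x = 0") (auto simp: indicator_def real_sqrt_minus ennreal_neg)
  qed
  ultimately show ?thesis
    unfolding nu1_def by (subst nn_integral_density) (simp_all add: mult.assoc)
qed

text \<open>These are the Catalan numbers divided by 4^k.\<close>

definition beta_moment :: "nat \<Rightarrow> real" where
  "beta_moment k = 2 / pi * Beta (real k + 1 / 2) (3 / 2)"

text \<open>Reduced to B(1/2, 1/2) = pi, the square of Gamma(1/2).\<close>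

lemma beta_moment_0: "beta_moment 0 = 1"
proof -
  have half: "(1 / 2 :: real) \<notin> \<int>\<^sub>\<le>\<^sub>0"
    using nonpos_Ints_nonpos by force
  have "(1 / 2 + 1 / 2) * Beta (1 / 2) (1 / 2 + 1 :: real) = 1 / 2 * Beta (1 / 2) (1 / 2)"
    using half by (rule Beta_plus1_right)
  moreover have "Beta (1 / 2) (1 / 2 :: real) = pi"
    by (simp add: Beta_def Gamma_one_half_real)
  ultimately show ?thesis by (simp add: beta_moment_def)
qed

lemma beta_moment_Suc: "(2 * real k + 4) * beta_moment (Suc k) = (2 * real k + 1) * beta_moment k"
proof -
  have "real k + 1 / 2 \<notin> \<int>\<^sub>\<le>\<^sub>0"
    using nonpos_Ints_nonpos[of "real k + 1 / 2"] by force
  from Beta_plus1_left[OF this, of "3 / 2"]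
  have "(2 * real k + 4) * Beta (real (Suc k) + 1 / 2) (3 / 2) = (2 * real k + 1) * Beta (real k + 1 / 2) (3 / 2)"
    by (simp add: algebra_simps)
  then have "2 / pi * ((2 * real k + 4) * Beta (real (Suc k) + 1 / 2) (3 / 2)) =
      2 / pi * ((2 * real k + 1) * Beta (real k + 1 / 2) (3 / 2))"
    by (simp only:)
  then show ?thesis
    unfolding beta_moment_def by (simp only: mult.left_commute)
qed

lemma beta_moment_nonneg: "0 \<le> beta_moment k"
proof -
  have "0 \<le> Beta (real k + 1 / 2) (3 / 2)"
    unfolding Beta_def by (intro divide_nonneg_nonneg mult_nonneg_nonneg less_imp_le[OF Gamma_real_pos]) simp_all
  then show ?thesis by (simp add: beta_moment_def)
qed

lemma prob_space_lambda1: "prob_space lambda1"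
  using lambda1_moment[of 0] by (intro prob_spaceI) (simp add: nn_integral_const)

lemma nu1_beta_moment: "(\<integral>\<^sup>+x. ennreal (x ^ k) \<partial>nu1) = ennreal (beta_moment k)"
  unfolding beta_moment_def by (rule nu1_moment)

lemma prob_space_nu1: "prob_space nu1"
  using nu1_beta_moment[of 0] beta_moment_0 by (intro prob_spaceI) simp

lemma sets_lambda1: "sets lambda1 = sets borel"
  by (simp add: lambda1_def)

lemma sets_nu1: "sets nu1 = sets borel"
  by (simp add: nu1_def)

lemma AE_lambda1: "AE x in lambda1. x \<in> {0..1}"
  unfolding lambda1_def by (subst AE_density) (auto simp: indicator_def)

lemma AE_nu1: "AE x in nu1. x \<in> {0..1}"
  unfolding nu1_def by (subst AE_density) (auto simp: indicator_def)


section \<open>The three laws\<close>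

theorem theorem5p1:
  fixes A :: "'a cstar" and u :: "nat \<Rightarrow> nat \<Rightarrow> 'a"
    and AA :: "'t cstar" and ten :: "'a \<Rightarrow> 'a \<Rightarrow> 't"
    and \<Delta> :: "'a \<Rightarrow> 't" and h :: "'a \<Rightarrow> complex" and s :: nat
  assumes "quantum_permutation_algebra 4 A u"
    and "min_tensor_product A A AA ten"
    and "comultiplication 4 A u AA ten \<Delta>"
    and "haar_functional A AA ten \<Delta> h"
    and "s \<in> {1, 2, 4}"
  shows "law A h (complex_of_real (1 / real s) \<odot>\<^bsub>A\<^esub> (\<Oplus>\<^bsub>A\<^esub>i\<in>{1..s}. u i i)) =
    mixture (real s / 4) (return borel 0) (mu s)"
proof -
  interpret Q: qperm4 A AA ten \<Delta> h u
    using assms by unfold_locales (simp_all add: min_tensor_product_def)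
  obtain F \<pi> where "qperm4_model A AA ten \<Delta> h F \<pi> u"
    using Q.ex_qperm4_model by (elim exE)
  then interpret qperm4_model A AA ten \<Delta> h F \<pi> u .
  have cl: "u i j \<in> carrier A" if "i \<in> {1, 2, 3, 4}" "j \<in> {1, 2, 3, 4}" for i j
    using u_closed that unfolding atLeastAtMost_1_4 by blast
  note [simp] = cl and [simp del] = One_nat_def
  consider "s = 1" | "s = 2" | "s = 4"
    using assms(5) by blast
  then show ?thesis
  proof cases
    case 1
    \<comment> \<open>A projection equals its positive powers, so every positive moment is
      1/4.\<close>
    have "is_law A h (u 1 1) (mixture (1 / 4) (return borel 0) (return borel 1))"
    proof (rule is_law_mixtureI[where m = "\<lambda>_. 1"])
      have "u 1 1 [^]\<^bsub>A\<^esub> Suc k = u 1 1" for k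
        by (induction k) (simp_all add: u_idem)
      then show "h (u 1 1 [^]\<^bsub>A\<^esub> Suc k) = complex_of_real (1 / 4 * 1)" for k
        using Q.entry_moment by (simp del: A.nat_pow_Suc)
    qed (simp_all add: return_moment prob_space_return AE_return h_one)
    moreover have "{1..1::nat} = {1}"
      by auto
    ultimately show ?thesis
      using 1 by (intro law_eqI) (simp add: mu_def)
  next
    case 2
    \<comment> \<open>The factor 2^k of \<open>corner_moment\<close> against (1/2)^(k+1) leaves 1/2
      times the moment 1/(k+2) of \<open>lambda1\<close>.\<close>
    have "is_law A h ((1 / 2) \<odot>\<^bsub>A\<^esub> (u 1 1 \<oplus>\<^bsub>A\<^esub> u 2 2)) (mixture (1 / 2) (return borel 0) lambda1)"
    proof (rule is_law_mixtureI[where m = "\<lambda>k. 1 / (real k + 1)"])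
      fix k
      have "h (((1 / 2) \<odot>\<^bsub>A\<^esub> (u 1 1 \<oplus>\<^bsub>A\<^esub> u 2 2)) [^]\<^bsub>A\<^esub> Suc k) =
          (1 / 2) ^ Suc k * (2 ^ k / (of_nat k + 2))"
        unfolding Q.corner_moment[symmetric] by (subst csmult_pow) (simp_all add: h_smult del: A.nat_pow_Suc)
      also have "\<dots> = 1 / 2 * (1 / (of_nat k + 2))"
        by (simp add: power_one_over)
      also have "\<dots> = complex_of_real (1 / 2 * (1 / (real (Suc k) + 1)))"
        by (simp add: add.commute)
      finally show "h (((1 / 2) \<odot>\<^bsub>A\<^esub> (u 1 1 \<oplus>\<^bsub>A\<^esub> u 2 2)) [^]\<^bsub>A\<^esub> Suc k) =
          complex_of_real (1 / 2 * (1 / (real (Suc k) + 1)))" .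
    qed (rule prob_space_lambda1 sets_lambda1 AE_lambda1 lambda1_moment h_one | simp)+
    moreover have "(\<Oplus>\<^bsub>A\<^esub>i\<in>{1..2}. u i i) = u 1 1 \<oplus>\<^bsub>A\<^esub> u 2 2"
    proof -
      have "{1..2::nat} = {1, 2}" by auto
      then show ?thesis by simp
    qed
    ultimately show ?thesis
      using 2 by (intro law_eqI) (simp add: mu_def)
  next
    case 3
    let ?D = "(u 1 1 \<oplus>\<^bsub>A\<^esub> u 2 2) \<oplus>\<^bsub>A\<^esub> (u 3 3 \<oplus>\<^bsub>A\<^esub> u 4 4)"
    \<comment> \<open>Both sides start at 1 and satisfy the same recursion:
      \<open>fix_sum_recursion\<close> is \<open>beta_moment_Suc\<close> scaled by powers of
      4.\<close>
    have moment: "h (?D [^]\<^bsub>A\<^esub> k) = 4 ^ k * complex_of_real (beta_moment k)" for k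
    proof (induction k)
      case 0
      show ?case by (simp add: h_one beta_moment_0)
    next
      case (Suc k)
      have "(real k + 2) * beta_moment (Suc k) = (2 * real k + 4) * beta_moment (Suc k) / 2"
        by simp
      also have "\<dots> = (2 * real k + 1) / 2 * beta_moment k"
        unfolding beta_moment_Suc by simp
      finally have m: "(of_nat k + 2) * complex_of_real (beta_moment (Suc k)) =
          (2 * of_nat k + 1) / 2 * complex_of_real (beta_moment k)"
        by (simp only: of_real_mult of_real_add of_real_divide of_real_of_nat_eq of_real_numeral of_real_1
            flip: of_real_eq_iff[where 'a = complex])
      have arith: "2 * a * (b * x) = 4 * b * (a / 2 * x)" for a b x :: complex
        by simp
      have "(of_nat k + 2) * h (?D [^]\<^bsub>A\<^esub> Suc k) =
          2 * (2 * of_nat k + 1) * (4 ^ k * complex_of_real (beta_moment k))"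
        unfolding Q.fix_sum_recursion Suc by (rule refl)
      also have "\<dots> = 4 ^ Suc k * ((2 * of_nat k + 1) / 2 * complex_of_real (beta_moment k))"
        unfolding power_Suc by (rule arith)
      also have "\<dots> = (of_nat k + 2) * (4 ^ Suc k * complex_of_real (beta_moment (Suc k)))"
        unfolding m[symmetric] by (rule mult.left_commute)
      finally show ?case
      proof (rule mult_left_cancel[THEN iffD1, rotated])
        have "of_nat (k + 2) \<noteq> (0 :: complex)"
          by (simp only: of_nat_eq_0_iff)
        then show "complex_of_nat k + 2 \<noteq> 0"
          by (simp add: add.commute)
      qed
    qed
    \<comment> \<open>With weight 1 the atom at 0 disappears.\<close>
    have "is_law A h ((1 / 4) \<odot>\<^bsub>A\<^esub> ?D) (mixture 1 (return borel 0) nu1)"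
    proof (rule is_law_mixtureI[where m = beta_moment])
      show "h (((1 / 4) \<odot>\<^bsub>A\<^esub> ?D) [^]\<^bsub>A\<^esub> Suc k) = complex_of_real (1 * beta_moment (Suc k))" for k
      proof -
        have "h (((1 / 4) \<odot>\<^bsub>A\<^esub> ?D) [^]\<^bsub>A\<^esub> Suc k) = (1 / 4) ^ Suc k * (4 ^ Suc k * complex_of_real (beta_moment (Suc k)))"
          unfolding moment[symmetric] by (subst csmult_pow) (simp_all add: h_smult del: A.nat_pow_Suc)
        also have "\<dots> = complex_of_real (beta_moment (Suc k))"
          by (simp only: mult.assoc[symmetric] power_mult_distrib[symmetric]) simp
        finally show ?thesis by simp
      qed
    qed (rule prob_space_nu1 sets_nu1 AE_nu1 nu1_beta_moment beta_moment_nonneg h_one | simp)+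
    moreover have "(\<Oplus>\<^bsub>A\<^esub>i\<in>{1..4}. u i i) = ?D"
      by (subst A.finsum_1_4) (simp_all add: A.a_assoc)
    ultimately show ?thesis
      using 3 by (intro law_eqI) (simp add: mu_def)
  qed
qed

end
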